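(* Let $X$ and $Y$ be compact Hausdorff spaces, let $M$ be a self-conjugate subspace of $C(X)$, and let $S\subseteq M$ be a function space on $X$. Let $\{T_n\}_{n\in\mathbb N}$ be a sequence of positive linear maps $T_n:M\to C(Y)$, and let $T_\infty:M\to C(Y)$ be an isometry (not assumed linear) of $M$ onto a subspace $T_\infty(M)$ of $C(Y)$. If $\|T_nf-T_\infty f\|\to0$ for every $f\in S$, then for every $f\in M$ and every compact subset $K\subseteq Ch(T_\infty(S))$, $\sup_{y\in K}|T_nf(y)-T_\infty f(y)|\to0$.
   Context: For a compact Hausdorff space $Z$, $C(Z)$ denotes the space of continuous scalar-valued functions on $Z$ (the scalars being either all real or all complex), with the supremum norm $\|\cdot\|$. A subspace $M\subseteq C(X)$ is self-conjugate if $\bar f\in M$ whenever $f\in M$. A function space on $X$ is a linear subspace of $C(X)$ containing the constant function $1$ and separating the points of $X$. A linear map $T:M\to C(Y)$ is positive if $Tf\ge 0$ whenever $f\ge 0$. An isometry means $\|T_\infty f-T_\infty g\|=\|f-g\|$ for all $f,g\in M$. For a linear subspace $A\subseteq C(Z)$, its Choquet boundary $Ch(A)$ is the set of points $z\in Z$ such that the evaluation functional $\delta_z:A\to$ scalars, $g\mapsto g(z)$, is an extreme point of the closed unit ball of the dual space of $(A,\|\cdot\|)$. *)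

theory Defs
  imports "HOL-Analysis.Analysis"
begin

text \<open>Scalars: a type of class real_normed_field (i.e. the reals or the complex numbers).
  Elements of C(Z) are represented by functions that are continuous on topspace Z
  and vanish outside topspace Z (so that each element of C(Z) has a unique representative).\<close>

definition Cfun :: "'a topology \<Rightarrow> ('a \<Rightarrow> 'k::real_normed_field) set" where
  "Cfun Z = {f. continuous_map Z euclidean f \<and> (\<forall>x. x \<notin> topspace Z \<longrightarrow> f x = 0)}"

definition supnorm :: "'a topology \<Rightarrow> ('a \<Rightarrow> 'k::real_normed_field) \<Rightarrow> real" where
  "supnorm Z f = Sup (insert 0 ((\<lambda>x. norm (f x)) ` topspace Z))"

text \<open>Complex conjugation, written intrinsically: for reals it is the identity,
  for complex numbers it is cnj (conj c = |c|^2 / c, and conj 0 = 0).\<close>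
definition sconj :: "'k::real_normed_field \<Rightarrow> 'k" where
  "sconj c = of_real ((norm c)\<^sup>2) / c"

definition lin_subspace :: "('a \<Rightarrow> 'k::real_normed_field) set \<Rightarrow> bool" where
  "lin_subspace A \<longleftrightarrow> (\<lambda>x. 0) \<in> A \<and> (\<forall>f\<in>A. \<forall>g\<in>A. (\<lambda>x. f x + g x) \<in> A)
     \<and> (\<forall>f\<in>A. \<forall>c. (\<lambda>x. c * f x) \<in> A)"

definition self_conjugate :: "('a \<Rightarrow> 'k::real_normed_field) set \<Rightarrow> bool" where
  "self_conjugate M \<longleftrightarrow> (\<forall>f\<in>M. (\<lambda>x. sconj (f x)) \<in> M)"

definition function_space :: "'a topology \<Rightarrow> ('a \<Rightarrow> 'k::real_normed_field) set \<Rightarrow> bool" where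
  "function_space X S \<longleftrightarrow> lin_subspace S \<and> S \<subseteq> Cfun X
     \<and> (\<lambda>x. if x \<in> topspace X then 1 else 0) \<in> S
     \<and> (\<forall>x\<in>topspace X. \<forall>y\<in>topspace X. x \<noteq> y \<longrightarrow> (\<exists>f\<in>S. f x \<noteq> f y))"

definition nonneg_on :: "'a set \<Rightarrow> ('a \<Rightarrow> 'k::real_normed_field) \<Rightarrow> bool" where
  "nonneg_on A f \<longleftrightarrow> (\<forall>x\<in>A. \<exists>r::real. r \<ge> 0 \<and> f x = of_real r)"

definition linear_map_on :: "('a \<Rightarrow> 'k::real_normed_field) set \<Rightarrow> (('a \<Rightarrow> 'k) \<Rightarrow> ('b \<Rightarrow> 'k)) \<Rightarrow> bool" where
  "linear_map_on A T \<longleftrightarrow>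
     (\<forall>f\<in>A. \<forall>g\<in>A. T (\<lambda>x. f x + g x) = (\<lambda>y. T f y + T g y))
   \<and> (\<forall>f\<in>A. \<forall>c. T (\<lambda>x. c * f x) = (\<lambda>y. c * T f y))"

definition linear_functional_on :: "('a \<Rightarrow> 'k::real_normed_field) set \<Rightarrow> (('a \<Rightarrow> 'k) \<Rightarrow> 'k) \<Rightarrow> bool" where
  "linear_functional_on A \<phi> \<longleftrightarrow>
     (\<forall>f\<in>A. \<forall>g\<in>A. (\<lambda>x. f x + g x) \<in> A \<longrightarrow> \<phi> (\<lambda>x. f x + g x) = \<phi> f + \<phi> g)
   \<and> (\<forall>f\<in>A. \<forall>c. (\<lambda>x. c * f x) \<in> A \<longrightarrow> \<phi> (\<lambda>x. c * f x) = c * \<phi> f)"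

definition positive_map_on :: "'a topology \<Rightarrow> 'b topology \<Rightarrow> ('a \<Rightarrow> 'k::real_normed_field) set
    \<Rightarrow> (('a \<Rightarrow> 'k) \<Rightarrow> ('b \<Rightarrow> 'k)) \<Rightarrow> bool" where
  "positive_map_on X Y A T \<longleftrightarrow> (\<forall>f\<in>A. nonneg_on (topspace X) f \<longrightarrow> nonneg_on (topspace Y) (T f))"

text \<open>Closed unit ball of the dual of (A, sup norm): linear functionals on A
  (functionals agreeing on A are identified) with norm at most 1.\<close>
definition dual_ball :: "'a topology \<Rightarrow> ('a \<Rightarrow> 'k::real_normed_field) set \<Rightarrow> (('a \<Rightarrow> 'k) \<Rightarrow> 'k) set" where
  "dual_ball Z A = {\<phi>. linear_functional_on A \<phi> \<and> (\<forall>g\<in>A. norm (\<phi> g) \<le> supnorm Z g)}"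

definition choquet_boundary :: "'a topology \<Rightarrow> ('a \<Rightarrow> 'k::real_normed_field) set \<Rightarrow> 'a set" where
  "choquet_boundary Z A = {z \<in> topspace Z.
      (\<lambda>g. g z) \<in> dual_ball Z A \<and>
      (\<forall>\<phi>1\<in>dual_ball Z A. \<forall>\<phi>2\<in>dual_ball Z A. \<forall>t::real. 0 < t \<and> t < 1 \<and>
          (\<forall>g\<in>A. g z = of_real t * \<phi>1 g + of_real (1 - t) * \<phi>2 g)
          \<longrightarrow> (\<forall>g\<in>A. \<phi>1 g = \<phi>2 g))}"

end

theory Submission
  imports Defs "HOL-Computational_Algebra.Fundamental_Theorem_Algebra"
begin

text \<open>Let \<open>y\<close> be a Choquet boundary point of \<open>Tinf ` S\<close>. The functional \<open>\<phi> g = Tinf g y\<close> on \<open>S\<close> is a limit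
  of positive functionals, hence a state, and it is extreme. Every positive extension of its real part to
  the bounded functions is multiplicative against real parts of elements of \<open>S\<close>, so the
  variances of these vanish and, on continuous functions, the extension is evaluation at a point
  \<open>x0\<close> determined by \<open>\<phi>\<close>. By Hahn--Banach, every
  continuous real \<open>f\<close> is then dominated by some \<open>re g\<close> with \<open>g\<close> in \<open>S\<close> and \<open>re (\<phi> g) < f x0 + e\<close>.

  This upper approximation does everything. Comparing with large constants, the isometry property
  alone (no linearity, no Mazur--Ulam theorem) gives \<open>re (Tinf f y) \<le> re (\<phi> g)\<close> whenever \<open>re f \<le> re g\<close>, so
  \<open>Tinf f y = f x0\<close> for all \<open>f\<close> in \<open>M\<close>. Positivity gives \<open>re (T n f) \<le> re (T n g)\<close>, where \<open>T n g\<close> tends to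
  \<open>Tinf g\<close> uniformly and \<open>re (Tinf g) < re (Tinf f) + e\<close> holds near \<open>y\<close>; finitely many such
  neighbourhoods cover \<open>K\<close>.\<close>

section \<open>Real polynomials evaluated in a normed field, and Ostrowski's minimum
  argument\<close>

section \<open>Real normed fields\<close>

text \<open>Real coefficients let one polynomial be evaluated both in \<open>complex\<close>, where
  it has roots, and at a scalar \<open>c\<close>, where norms are estimated.\<close>

definition eval_at :: "'k::real_normed_field \<Rightarrow> real poly \<Rightarrow> 'k" where
  "eval_at c p = poly (map_poly of_real p) c"

lemma eval_at_0 [simp]: "eval_at c 0 = 0"
  by (simp add: eval_at_def)

lemma eval_at_pCons [simp]: "eval_at c (pCons a p) = of_real a + c * eval_at c p"
  by (simp add: eval_at_def map_poly_pCons)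

lemma eval_at_1 [simp]: "eval_at c 1 = 1"
  by (simp add: one_pCons)

lemma eval_at_add [simp]: "eval_at c (p + q) = eval_at c p + eval_at c q"
proof (induction p arbitrary: q)
  case (pCons a p)
  then show ?case by (cases q) (simp add: algebra_simps)
qed simp

lemma eval_at_smult [simp]: "eval_at c (smult r p) = of_real r * eval_at c p"
  by (induction p) (simp_all add: algebra_simps)

lemma eval_at_diff [simp]: "eval_at c (p - q) = eval_at c p - eval_at c q"
  using eval_at_add[of c "p - q" q] by simp

lemma eval_at_mult [simp]: "eval_at c (p * q) = eval_at c p * eval_at c q"
  by (induction p) (simp_all add: algebra_simps)

lemma eval_at_power [simp]: "eval_at c (p ^ n) = eval_at c p ^ n"
  by (induction n) simp_all

text \<open>The product (t - z)(t - cnj z), which has real coefficients and vanishes at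
  \<open>z\<close>.\<close>

definition conj_quadratic :: "complex \<Rightarrow> real poly" where
  "conj_quadratic z = [:(cmod z)\<^sup>2, - 2 * Re z, 1:]"

lemma conj_quadratic_degree [simp]: "degree (conj_quadratic z) = 2"
  by (simp add: conj_quadratic_def)

lemma conj_quadratic_coeff_2 [simp]: "coeff (conj_quadratic z) 2 = 1"
  by (simp add: conj_quadratic_def numeral_2_eq_2)

lemma conj_quadratic_root [simp]: "eval_at z (conj_quadratic z) = 0"
  using cmod_power2[of z]
  by (simp add: conj_quadratic_def complex_eq_iff power2_eq_square algebra_simps)

text \<open>The remainder \<open>r0 + r1 * t\<close> has real coefficients and vanishes at
  \<open>z\<close>; the imaginary part forces \<open>r1 = 0\<close>, and then
  \<open>r0 = 0\<close>.\<close>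

lemma conj_quadratic_dvd:
  assumes root: "eval_at z p = 0" and "Im z \<noteq> 0"
  shows "conj_quadratic z dvd p"
proof -
  define r where "r = p mod conj_quadratic z"
  have p: "p = p div conj_quadratic z * conj_quadratic z + r"
    by (simp add: r_def)
  have "conj_quadratic z \<noteq> 0"
    by (simp add: conj_quadratic_def)
  then have "degree r < 2"
    using degree_mod_less'[of "conj_quadratic z" p] by (cases "r = 0") (auto simp: r_def)
  then obtain r0 r1 where r: "r = [:r0, r1:]"
    by (metis degree_eq_zeroE degree_pCons_eq_if less_2_cases_iff nat.inject One_nat_def
        pCons_cases pCons_0_0 degree_0 degree_pCons_0)
  have "eval_at z r = 0"
    using root by (subst (asm) p) simp
  then have "r = 0"
    using \<open>Im z \<noteq> 0\<close> by (auto simp: r complex_eq_iff)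
  then show ?thesis
    by (simp add: r_def dvd_eq_mod_eq_0)
qed

text \<open>Over the reals the polynomial splits into linear factors and factors \<^term>\<open>conj_quadratic z\<close>;
  for a linear factor with root \<open>a\<close>, the quadratic of \<open>a\<close> is the square of the factor.\<close>

lemma monic_eval_lower_bound:
  fixes c :: "'k::real_normed_field"
  assumes m: "\<And>z. m \<le> norm (eval_at c (conj_quadratic z))" "0 \<le> m"
    and "lead_coeff p = 1"
  shows "m ^ degree p \<le> (norm (eval_at c p))\<^sup>2"
  using \<open>lead_coeff p = 1\<close>
proof (induction "degree p" arbitrary: p rule: less_induct)
  case less
  show ?case
  proof (cases "degree p = 0")
    case True
    then show ?thesis
      using less.prems by (auto elim!: degree_eq_zeroE)
  next
    case False
    have "\<not> constant (poly (map_poly complex_of_real p))"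
      using False by (simp add: constant_degree degree_map_poly)
    then obtain w :: complex where w: "eval_at w p = 0"
      unfolding eval_at_def using fundamental_theorem_of_algebra[of "map_poly of_real p"] by blast
    \<comment> \<open>Here \<open>q\<close> stands for a linear or quadratic factor, and the
      induction hypothesis handles the cofactor. The square in the bound accommodates a linear
      factor: its square is a quadratic, so it contributes one power of \<open>m\<close>.\<close>
    have step: "m ^ degree p \<le> (norm (eval_at c p))\<^sup>2"
      if q: "q dvd p" "lead_coeff q = 1" "degree q > 0"
        "m ^ degree q \<le> (norm (eval_at c q))\<^sup>2" for q
    proof -
      obtain s where s: "p = q * s"
        using q(1) by blast
      have "lead_coeff s = 1"
        using less.prems q(2) unfolding s lead_coeff_mult by simp
      moreover have deg: "degree p = degree q + degree s"
        using less.prems q(2) unfolding s by (subst degree_mult_eq) auto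
      ultimately have "m ^ degree s \<le> (norm (eval_at c s))\<^sup>2"
        using less.hyps[of s] q(3) by simp
      then show ?thesis
        using mult_mono[OF q(4), of "m ^ degree s" "(norm (eval_at c s))\<^sup>2"] m(2)
        by (simp add: deg power_add) (simp add: s norm_mult power_mult_distrib)
    qed
    show ?thesis
    proof (cases "Im w = 0")
      case True
      define a where "a = Re w"
      have wa: "w = of_real a"
        using True by (simp add: a_def complex_eq_iff)
      have "eval_at w p = of_real (poly p a)"
        by (induction p) (simp_all add: wa)
      then have "[:- a, 1:] dvd p"
        using w by (simp add: poly_eq_0_iff_dvd)
      moreover have "eval_at c (conj_quadratic w) = (eval_at c [:- a, 1:])\<^sup>2"
        by (simp add: conj_quadratic_def wa power2_eq_square algebra_simps)
      then have "m \<le> (norm (eval_at c [:- a, 1:]))\<^sup>2"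
        using m(1)[of w] by (simp add: norm_power)
      ultimately show ?thesis
        by (intro step) auto
    next
      case False
      show ?thesis
      proof (intro step)
        show "conj_quadratic w dvd p"
          using conj_quadratic_dvd[OF w False] .
        show "m ^ degree (conj_quadratic w) \<le> (norm (eval_at c (conj_quadratic w)))\<^sup>2"
          using m by (simp add: power_mono)
      qed auto
    qed
  qed
qed

text \<open>Ostrowski's argument: if the modulus \<open>f\<close> of the quadratics at \<open>c\<close> had a minimum \<open>m > 0\<close>, take a minimiser
  \<open>z0\<close> farthest from the origin and \<open>w\<close> with quadratic shifted by \<open>e < m\<close>, so \<open>f w > m\<close>. The quadratic of \<open>w\<close>
  divides \<open>q(z0)^n - (-e)^n\<close>, whose value at \<open>c\<close> has norm at most \<open>m^n + e^n\<close>; letting \<open>n\<close> grow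
  gives \<open>f w \<le> m\<close>.\<close>

lemma real_normed_field_quadratic:
  fixes c :: "'k::real_normed_field"
  shows "\<exists>z. eval_at c (conj_quadratic z) = 0"
proof (rule ccontr)
  assume no_root: "\<nexists>z. eval_at c (conj_quadratic z) = 0"
  define f where "f z = norm (eval_at c (conj_quadratic z))" for z
  have f_eq: "f z = norm (c * c - of_real (2 * Re z) * c + of_real ((cmod z)\<^sup>2))" for z
    by (simp add: f_def conj_quadratic_def algebra_simps)
  have cont: "continuous_on A f" for A
    unfolding f_eq[abs_def] by (intro continuous_intros)
  \<comment> \<open>The constant term of the quadratic grows like the square of
    \<open>cmod z\<close> and the other terms at most linearly, so \<open>f z \<le> f 0\<close>
    confines \<open>z\<close> to the disc \<open>D\<close> below. A minimum over \<open>D\<close> is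
    therefore global.\<close>
  have growth: "cmod z \<le> 2 * norm c + f 0 + 1 + norm c * norm c" if "f z \<le> f 0" for z
  proof (rule ccontr)
    let ?n = "norm c" and ?z = "cmod z"
    assume big: "\<not> ?thesis"
    have "?z\<^sup>2 = norm (of_real (?z\<^sup>2) :: 'k)"
      by (simp only: norm_of_real) simp
    also have "(of_real (?z\<^sup>2) :: 'k) =
        (c * c - of_real (2 * Re z) * c + of_real (?z\<^sup>2)) - c * c + of_real (2 * Re z) * c"
      by simp
    also have "norm \<dots> \<le> f z + norm (c * c) + norm (of_real (2 * Re z) * c)"
      unfolding f_eq by (intro order_trans[OF norm_triangle_ineq] add_right_mono norm_triangle_ineq4)
    also have "\<dots> \<le> f 0 + ?n * ?n + 2 * ?z * ?n"
      using that abs_Re_le_cmod[of z] by (intro add_mono) (auto simp: norm_mult mult_right_mono)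
    finally have "?z * (?z - 2 * ?n) \<le> f 0 + ?n * ?n"
      by (simp add: power2_eq_square algebra_simps)
    moreover have "1 * (f 0 + 1 + ?n * ?n) \<le> ?z * (?z - 2 * ?n)"
      using big by (intro mult_mono) (auto simp: f_def add_nonneg_nonneg intro: order_trans[of _ "2 * ?n + f 0 + 1 + ?n * ?n"])
    ultimately show False
      by simp
  qed
  define D where "D = cball (0::complex) (2 * norm c + f 0 + 1 + norm c * norm c)"
  have D: "compact D" "0 \<in> D"
    by (auto simp: D_def f_def)
  obtain z1 where z1: "z1 \<in> D" "\<And>z. z \<in> D \<Longrightarrow> f z1 \<le> f z"
    using continuous_attains_inf[of D f] D cont by blast
  define m where "m = f z1"
  have m: "m \<le> f z" for z
    using z1 growth[of z] D(2) unfolding m_def D_def by (cases "f z \<le> f 0") fastforce+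
  have "m > 0"
    using no_root by (simp add: m_def f_def)
  define Z where "Z = {z \<in> D. f z = m}"
  have "closed {z. f z = m}"
    using continuous_closed_preimage_constant[of UNIV f m] cont by simp
  then have "compact Z"
    using D(1) unfolding Z_def by (metis Collect_conj_eq Collect_mem_eq compact_Int_closed)
  moreover have "z1 \<in> Z"
    using z1 by (simp add: Z_def m_def)
  ultimately obtain z0 where z0: "z0 \<in> Z" "\<And>z. z \<in> Z \<Longrightarrow> cmod z \<le> cmod z0"
    using continuous_attains_sup[of Z cmod] by (auto intro: continuous_intros)
  define e where "e = m / 2"
  have e: "0 < e" "e < m"
    using \<open>m > 0\<close> by (auto simp: e_def)
  \<comment> \<open>Raising the squared imaginary part by \<open>e\<close> adds \<open>e\<close> to
    the constant term of the quadratic and keeps the linear term.\<close>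
  define w where "w = Complex (Re z0) (sqrt ((Im z0)\<^sup>2 + e))"
  have cw: "(cmod w)\<^sup>2 = (cmod z0)\<^sup>2 + e"
    using e by (simp add: w_def cmod_power2)
  have quad_w: "conj_quadratic w = conj_quadratic z0 - [:- e:]"
    by (simp add: conj_quadratic_def cw) (simp add: w_def)
  have "cmod z0 < cmod w"
    using cw e by (intro power2_less_imp_less[of "cmod z0"]) auto
  moreover have "cmod w \<le> cmod z0" if "f w = m"
    using that z0(2) m[of 0] growth[of w] by (auto simp: Z_def D_def)
  ultimately have "f w > m"
    using m[of w] by fastforce
  have bound: "f w \<le> m * (1 + (1/2) ^ n)" if n: "n > 0" for n
  proof -
    define G where "G = conj_quadratic z0 ^ n - [:(- e) ^ n:]"
    have "conj_quadratic w dvd G"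
    proof -
      have "conj_quadratic z0 - [:- e:] dvd conj_quadratic z0 ^ n - [:- e:] ^ n"
        using power_diff_sumr2[of "conj_quadratic z0" n "[:- e:]"] by simp
      then show ?thesis
        by (simp add: quad_w G_def poly_const_pow)
    qed
    then obtain H where H: "G = conj_quadratic w * H"
      by blast
    have degp: "degree (conj_quadratic z0 ^ n) = 2 * n"
      by (simp add: degree_power_eq conj_quadratic_def)
    have degG: "degree G = 2 * n"
      unfolding G_def diff_conv_add_uminus using degp n by (subst degree_add_eq_left) auto
    have "lead_coeff G = 1"
      using degp n lead_coeff_power[of "conj_quadratic z0" n] unfolding degG
      by (simp add: G_def coeff_pCons split: nat.split)
    then have lH: "lead_coeff H = 1"
      unfolding H lead_coeff_mult by simp
    have "degree G = 2 + degree H"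
      unfolding H using lH by (subst degree_mult_eq) (auto simp: conj_quadratic_def)
    then have "degree H = 2 * (n - 1)"
      using degG by simp
    \<comment> \<open>Dividing by this lower bound for the cofactor \<open>H\<close> will isolate
      \<open>f w\<close> in the estimate of \<open>G\<close>.\<close>
    then have "(m ^ (n - 1))\<^sup>2 \<le> (norm (eval_at c H))\<^sup>2"
      using monic_eval_lower_bound[of m c H] m lH \<open>m > 0\<close>
      by (simp add: f_def power_mult power_commutes mult.commute flip: power_mult)
    then have "m ^ (n - 1) \<le> norm (eval_at c H)"
      by (rule power2_le_imp_le) simp
    then have "f w * m ^ (n - 1) \<le> norm (eval_at c G)"
      unfolding H by (simp add: norm_mult f_def mult_left_mono)
    also have "\<dots> \<le> norm (eval_at c (conj_quadratic z0) ^ n) + norm (of_real ((- e) ^ n) :: 'k)"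
      unfolding G_def by (simp only: eval_at_diff eval_at_power) (simp add: norm_triangle_ineq4)
    also have "\<dots> = m ^ n + e ^ n"
      using z0(1) e by (simp add: norm_power Z_def f_def power_abs)
    also have "\<dots> = m ^ (n - 1) * (m * (1 + (1/2) ^ n))"
      using n by (cases n) (simp_all add: e_def power_divide field_simps)
    finally show ?thesis
      using \<open>m > 0\<close> by (simp add: mult.commute)
  qed
  have "(\<lambda>n. m * (1 + (1/2) ^ n)) \<longlonglongrightarrow> m * (1 + 0)"
    by (intro tendsto_intros LIMSEQ_realpow_zero) auto
  then have "f w \<le> m * (1 + 0)"
    by (rule LIMSEQ_le_const) (use bound in \<open>auto intro!: exI[of _ 1]\<close>)
  then show False
    using \<open>f w > m\<close> by simp
qed

text \<open>By Gelfand--Mazur the scalars are the reals or the complex numbers. Both cases are handled at once: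
  \<open>J\<close> is an imaginary unit in the complex case and \<open>0\<close> in the real case, and the imaginary part of
  \<open>c\<close> is \<open>- re (J * c)\<close>.\<close>

locale real_part =
  fixes re :: "'k::real_normed_field \<Rightarrow> real" and J :: 'k
  assumes re_add: "re (a + b) = re a + re b"
    and re_of_real_mult: "re (of_real r * a) = r * re a"
    and re_1: "re 1 = 1"
    and J_cases: "J = 0 \<or> J * J = - 1"
    and decomp: "c = of_real (re c) - J * of_real (re (J * c))"
    and norm_power2: "(norm c)\<^sup>2 = (re c)\<^sup>2 + (re (J * c))\<^sup>2"

text \<open>The real part is transported from \<open>complex\<close> along the isometric
  identification \<open>\<kappa>\<close>, which sends \<open>\<i>\<close> to \<open>j\<close>. The
  fields of the locale then become identities between complex numbers.\<close>

lemma real_part_of_isomorphism: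
  fixes \<kappa> :: "complex \<Rightarrow> 'k::real_normed_field"
  assumes \<kappa>: "\<And>z. \<kappa> z = of_real (Re z) + j * of_real (Im z)" and j: "j * j = - 1"
    and norm: "\<And>z. norm (\<kappa> z) = cmod z" and "surj \<kappa>"
  shows "real_part (\<lambda>c. Re (inv \<kappa> c)) j"
proof -
  have "inj \<kappa>"
  proof (rule injI)
    fix z w assume "\<kappa> z = \<kappa> w"
    then have "\<kappa> (z - w) = 0"
      by (simp add: \<kappa> algebra_simps)
    then show "z = w"
      using norm[of "z - w"] by simp
  qed
  then have inv: "inv \<kappa> (\<kappa> z) = z" for z
    by simp
  have add: "\<kappa> (z + w) = \<kappa> z + \<kappa> w" for z w
    by (simp add: \<kappa> algebra_simps)
  have scale: "of_real r * \<kappa> z = \<kappa> (of_real r * z)" for r z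
    by (simp add: \<kappa> algebra_simps)
  have j_mult: "j * \<kappa> z = \<kappa> (\<i> * z)" for z
  proof -
    have "j * \<kappa> z = j * of_real (Re z) + (j * j) * of_real (Im z)"
      by (simp add: \<kappa> algebra_simps)
    then show ?thesis
      by (simp add: j \<kappa>)
  qed
  have one: "(1::'k) = \<kappa> 1"
    by (simp add: \<kappa>)
  have ex: "\<exists>z. c = \<kappa> z" for c
    using \<open>surj \<kappa>\<close> by blast
  show ?thesis
  proof
    fix a b c :: 'k and r
    obtain z w v where [simp]: "a = \<kappa> z" "b = \<kappa> w" "c = \<kappa> v"
      using ex[of a] ex[of b] ex[of c] by blast
    show "Re (inv \<kappa> (a + b)) = Re (inv \<kappa> a) + Re (inv \<kappa> b)"
      by (simp add: inv flip: add)
    show "Re (inv \<kappa> (of_real r * a)) = r * Re (inv \<kappa> a)"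
      by (simp add: inv scale)
    show "c = of_real (Re (inv \<kappa> c)) - j * of_real (Re (inv \<kappa> (j * c)))"
      by (simp add: inv j_mult) (simp add: \<kappa>)
    show "(norm c)\<^sup>2 = (Re (inv \<kappa> c))\<^sup>2 + (Re (inv \<kappa> (j * c)))\<^sup>2"
      by (simp add: inv j_mult norm cmod_power2)
  qed (auto simp: one inv j)
qed

text \<open>The case split is whether -1 has a square root \<open>j\<close>. If so,
  \<open>a + b * \<i> \<mapsto> a + b * j\<close> is isometric and onto; if not, the quadratic
  satisfied by each scalar forces it to be real.\<close>

lemma ex_real_part: "\<exists>re (J :: 'k::real_normed_field). real_part re J"
proof (cases "\<exists>j::'k. j * j = - 1")
  case True
  then obtain j :: 'k where j: "j * j = - 1"
    by blast
  define \<kappa> where "\<kappa> z = of_real (Re z) + j * of_real (Im z)" for z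
  have mult: "\<kappa> (z * w) = \<kappa> z * \<kappa> w" for z w
  proof -
    have "\<kappa> z * \<kappa> w = of_real (Re z * Re w) + (j * j) * of_real (Im z * Im w)
        + j * of_real (Re z * Im w + Im z * Re w)"
      by (simp add: \<kappa>_def algebra_simps)
    then show ?thesis
      by (simp add: j \<kappa>_def)
  qed
  have power: "\<kappa> (z ^ n) = \<kappa> z ^ n" for z n
    by (induction n) (simp_all add: mult, simp add: \<kappa>_def)
  have "(norm j)\<^sup>2 = 1"
    using arg_cong[OF j, of norm] by (simp add: norm_mult power2_eq_square)
  then have "norm j = 1"
    using power2_eq_iff_nonneg[of "norm j" 1] by simp
  then have le2: "norm (\<kappa> z) \<le> 2 * cmod z" for z
    using norm_triangle_ineq[of "of_real (Re z)" "j * of_real (Im z)"]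
      abs_Re_le_cmod[of z] abs_Im_le_cmod[of z]
    by (simp add: \<kappa>_def norm_mult)
  \<comment> \<open>Power trick: both norms are multiplicative, so any excess of
    \<open>norm (\<kappa> z)\<close> over \<open>cmod z\<close> would grow beyond the factor 2 on a
    high power of \<open>z\<close>. The reverse inequality then follows by applying this one to the
    inverse of \<open>z\<close>.\<close>
  have le: "norm (\<kappa> z) \<le> cmod z" for z
  proof (cases "z = 0")
    case True
    then show ?thesis
      by (simp add: \<kappa>_def)
  next
    case False
    show ?thesis
    proof (rule ccontr)
      assume "\<not> ?thesis"
      then have "1 < norm (\<kappa> z) / cmod z"
        using False by simp
      then obtain n where "2 < (norm (\<kappa> z) / cmod z) ^ n"
        using real_arch_pow by blast
      then have "2 * cmod (z ^ n) < norm (\<kappa> (z ^ n))"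
        using False by (simp add: power_divide norm_power power field_simps)
      then show False
        using le2[of "z ^ n"] by simp
    qed
  qed
  have norm: "norm (\<kappa> z) = cmod z" for z
  proof (cases "z = 0")
    case False
    have "norm (\<kappa> (z * inverse z)) = 1"
      using False by (simp add: \<kappa>_def)
    then have "1 \<le> norm (\<kappa> z) * inverse (cmod z)"
      using mult_left_mono[OF le[of "inverse z"], of "norm (\<kappa> z)"]
      by (simp only: mult norm_mult norm_inverse norm_ge_zero)
    then show ?thesis
      using le[of z] False by (simp add: field_simps)
  qed (simp add: \<kappa>_def)
  have range: "c \<in> range \<kappa>" for c
  proof -
    obtain z where z: "eval_at c (conj_quadratic z) = 0"
      using real_normed_field_quadratic by blast
    \<comment> \<open>The quadratic splits over the range of \<open>\<kappa>\<close>, so its root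
      \<open>c\<close> is one of the two images.\<close>
    have "(c - \<kappa> z) * (c - \<kappa> (cnj z)) =
        c * c - of_real (2 * Re z) * c + of_real (Re z * Re z) - (j * j) * of_real (Im z * Im z)"
      by (simp add: \<kappa>_def algebra_simps)
    also have "\<dots> = eval_at c (conj_quadratic z)"
      by (simp add: j conj_quadratic_def cmod_power2 power2_eq_square[of "Re z"]
          power2_eq_square[of "Im z"] algebra_simps)
    finally have "c = \<kappa> z \<or> c = \<kappa> (cnj z)"
      using z by simp
    then show ?thesis
      by blast
  qed
  have "real_part (\<lambda>c. Re (inv \<kappa> c)) j"
  proof (rule real_part_of_isomorphism[OF _ j norm])
    show "surj \<kappa>"
      using range by blast
  qed (rule \<kappa>_def)
  then show ?thesis
    by blast
next
  case False
  have real: "\<exists>r. c = of_real r" for c :: 'k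
  proof -
    obtain z where z: "eval_at c (conj_quadratic z) = 0"
      using real_normed_field_quadratic by blast
    define d where "d = c - of_real (Re z)"
    have "d * d + of_real (Im z * Im z) = eval_at c (conj_quadratic z)"
      by (simp add: d_def conj_quadratic_def cmod_power2 power2_eq_square[of "Re z"]
          power2_eq_square[of "Im z"] algebra_simps)
    then have d: "d * d = - of_real (Im z * Im z)"
      using z by (simp add: eq_neg_iff_add_eq_0)
    \<comment> \<open>Otherwise dividing \<open>d\<close> by the imaginary part would produce a
      square root of -1.\<close>
    have "Im z = 0"
    proof (rule ccontr)
      assume "Im z \<noteq> 0"
      then have "d / of_real (Im z) * (d / of_real (Im z)) = - 1"
        by (simp add: d)
      then show False
        using False by blast
    qed
    then show ?thesis
      using d by (auto simp: d_def)
  qed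
  define re where "re c = (SOME r. c = of_real r)" for c :: 'k
  have of_real_re: "of_real (re c) = c" for c
    unfolding re_def using someI_ex[OF real[of c]] by simp
  have re_of_real: "re (of_real r) = r" for r
    using of_real_re[of "of_real r"] by simp
  have "real_part re 0"
  proof
    fix a b c :: 'k and r
    show "re (a + b) = re a + re b"
      using re_of_real[of "re a + re b"] by (simp add: of_real_re)
    show "re (of_real r * a) = r * re a"
      using re_of_real[of "r * re a"] by (simp add: of_real_re)
    show "re 1 = 1"
      using re_of_real[of 1] by simp
    show "c = of_real (re c) - 0 * of_real (re (0 * c))"
      by (simp add: of_real_re)
    show "(norm c)\<^sup>2 = (re c)\<^sup>2 + (re (0 * c))\<^sup>2"
      using re_of_real[of 0] norm_of_real[of "re c", where 'a='k] by (simp add: of_real_re)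
  qed simp
  then show ?thesis
    by blast
qed

section \<open>The Hahn-Banach theorem by way of minimal sublinear functionals\<close>

section \<open>Sublinear functionals\<close>

text \<open>Positive homogeneity is stated as an inequality for \<open>t > 0\<close>; on a subspace,
  applying it to \<open>inverse t\<close> turns it into an equality.\<close>

definition sublinear_on :: "('a \<Rightarrow> real) set \<Rightarrow> (('a \<Rightarrow> real) \<Rightarrow> real) \<Rightarrow> bool" where
  "sublinear_on B q \<longleftrightarrow> (\<forall>h\<in>B. \<forall>k\<in>B. q (\<lambda>x. h x + k x) \<le> q h + q k)
     \<and> (\<forall>h\<in>B. \<forall>t>0. q (\<lambda>x. t * h x) \<le> t * q h)"

lemma sublinear_on_add:
  "\<lbrakk>sublinear_on B q; h \<in> B; k \<in> B\<rbrakk> \<Longrightarrow> q (\<lambda>x. h x + k x) \<le> q h + q k"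
  unfolding sublinear_on_def by blast

lemma sublinear_on_scale_le:
  "\<lbrakk>sublinear_on B q; h \<in> B; t > 0\<rbrakk> \<Longrightarrow> q (\<lambda>x. t * h x) \<le> t * q h"
  unfolding sublinear_on_def by blast

lemma lin_subspace_zero: "lin_subspace A \<Longrightarrow> (\<lambda>x. 0) \<in> A"
  unfolding lin_subspace_def by blast

lemma lin_subspace_add: "\<lbrakk>lin_subspace A; f \<in> A; g \<in> A\<rbrakk> \<Longrightarrow> (\<lambda>x. f x + g x) \<in> A"
  unfolding lin_subspace_def by blast

lemma lin_subspace_scale: "\<lbrakk>lin_subspace A; f \<in> A\<rbrakk> \<Longrightarrow> (\<lambda>x. c * f x) \<in> A"
  unfolding lin_subspace_def by blast

lemma sublinear_on_zero:
  assumes "lin_subspace B" "sublinear_on B q"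
  shows "q (\<lambda>x. 0) = 0"
proof -
  have "(\<lambda>x. 0) \<in> B"
    using assms(1) by (simp add: lin_subspace_def)
  then have "q (\<lambda>x. 0 + 0) \<le> q (\<lambda>x. 0) + q (\<lambda>x. 0)" "q (\<lambda>x. 1/2 * 0) \<le> 1/2 * q (\<lambda>x. 0)"
    using sublinear_on_add[OF assms(2)] sublinear_on_scale_le[OF assms(2), of _ "1/2"] by fastforce+
  then show ?thesis
    by simp
qed

lemma sublinear_on_scale:
  assumes B: "lin_subspace B" and q: "sublinear_on B q" and "h \<in> B" "t \<ge> 0"
  shows "q (\<lambda>x. t * h x) = t * q h"
proof (cases "t = 0")
  case True
  then show ?thesis
    using sublinear_on_zero[OF B q] by simp
next
  case False
  then have "t > 0"
    using \<open>t \<ge> 0\<close> by simp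
  have th: "(\<lambda>x. t * h x) \<in> B"
    using \<open>h \<in> B\<close> by (rule lin_subspace_scale[OF B])
  have "q (\<lambda>x. inverse t * (t * h x)) \<le> inverse t * q (\<lambda>x. t * h x)"
    using \<open>t > 0\<close> by (intro sublinear_on_scale_le[OF q th]) simp
  moreover have "(\<lambda>x. inverse t * (t * h x)) = h"
    using \<open>t > 0\<close> by auto
  ultimately have "t * q h \<le> q (\<lambda>x. t * h x)"
    using \<open>t > 0\<close> by (simp add: field_simps)
  then show ?thesis
    using sublinear_on_scale_le[OF q \<open>h \<in> B\<close> \<open>t > 0\<close>] by simp
qed

text \<open>Take the infimum over \<open>t \<ge> 0\<close> of
  \<open>q (v + t * h) - t * q h\<close>: the choices \<open>t = 0\<close> and \<open>t = 1\<close>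
  give the two bounds. The second bound is what makes a minimal functional additive.\<close>

lemma sublinear_on_shift:
  fixes q :: "('a \<Rightarrow> real) \<Rightarrow> real"
  assumes B: "lin_subspace B" and q: "sublinear_on B q" and h: "h \<in> B"
  obtains q' where "sublinear_on B q'" "\<And>v. v \<in> B \<Longrightarrow> q' v \<le> q v"
    "\<And>v. v \<in> B \<Longrightarrow> q' v \<le> q (\<lambda>x. v x + h x) - q h"
proof -
  note add = lin_subspace_add[OF B] and scale = lin_subspace_scale[OF B]
  have sub: "q (\<lambda>x. u x + v x) \<le> q u + q v" if "u \<in> B" "v \<in> B" for u v
    using that by (rule sublinear_on_add[OF q])
  define g where "g v t = q (\<lambda>x. v x + t * h x) - t * q h" for v t
  \<comment> \<open>Subadditivity applied to \<open>t * h = (v + t * h) + (- v)\<close> gives a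
    lower bound that does not depend on \<open>t\<close>.\<close>
  have bdd: "bdd_below (g v ` {0..})" if v: "v \<in> B" for v
  proof (rule bdd_belowI2[of _ "- q (\<lambda>x. - 1 * v x)"])
    fix t :: real assume "t \<in> {0..}"
    then have "t * q h = q (\<lambda>x. (v x + t * h x) + (- 1 * v x))"
      using sublinear_on_scale[OF B q h, of t] by simp
    also have "\<dots> \<le> q (\<lambda>x. v x + t * h x) + q (\<lambda>x. - 1 * v x)"
      by (intro sub add scale v h)
    finally show "- q (\<lambda>x. - 1 * v x) \<le> g v t"
      by (simp add: g_def)
  qed
  define q' where "q' v = (if v \<in> B then Inf (g v ` {0..}) else 0)" for v
  have lower: "q' v \<le> g v t" if "v \<in> B" "t \<ge> 0" for v t
    using that bdd by (auto simp: q'_def intro: cInf_lower)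
  have greatest: "z \<le> q' v" if "v \<in> B" "\<And>t. t \<ge> 0 \<Longrightarrow> z \<le> g v t" for v z
    using that by (auto simp: q'_def intro!: cInf_greatest)
  show thesis
  proof
    show "sublinear_on B q'"
      unfolding sublinear_on_def
    proof (intro conjI ballI allI impI)
      fix u v assume u: "u \<in> B" and v: "v \<in> B"
      have *: "q' (\<lambda>x. u x + v x) \<le> g u s + g v t" if "s \<ge> 0" "t \<ge> 0" for s t
      proof -
        have "q' (\<lambda>x. u x + v x) \<le> g (\<lambda>x. u x + v x) (s + t)"
          using that by (intro lower add u v) auto
        also have "\<dots> = q (\<lambda>x. (u x + s * h x) + (v x + t * h x)) - (s + t) * q h"
          by (simp add: g_def algebra_simps)
        also have "\<dots> \<le> g u s + g v t"
          using sub[of "\<lambda>x. u x + s * h x" "\<lambda>x. v x + t * h x"] add scale u v h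
          by (simp add: g_def algebra_simps)
        finally show ?thesis .
      qed
      have "q' (\<lambda>x. u x + v x) - g u s \<le> q' v" if "s \<ge> 0" for s
        using *[OF that] by (intro greatest v) (simp add: algebra_simps)
      then have "q' (\<lambda>x. u x + v x) - q' v \<le> q' u"
        by (intro greatest u) (simp add: algebra_simps)
      then show "q' (\<lambda>x. u x + v x) \<le> q' u + q' v"
        by simp
    next
      fix v and s :: real assume v: "v \<in> B" and s: "s > 0"
      have "q' (\<lambda>x. s * v x) / s \<le> g v t" if "t \<ge> 0" for t
      proof -
        have "q' (\<lambda>x. s * v x) \<le> g (\<lambda>x. s * v x) (s * t)"
          using that s by (intro lower scale v) auto
        also have "\<dots> = q (\<lambda>x. s * (v x + t * h x)) - s * t * q h"
          by (simp add: g_def algebra_simps)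
        also have "\<dots> = s * g v t"
          using sublinear_on_scale[OF B q add[OF v scale[OF h]], of s t] s
          by (simp add: g_def algebra_simps)
        finally show ?thesis
          using s by (simp add: field_simps)
      qed
      then have "q' (\<lambda>x. s * v x) / s \<le> q' v"
        by (intro greatest v)
      then show "q' (\<lambda>x. s * v x) \<le> s * q' v"
        using s by (simp add: field_simps)
    qed
    show "q' v \<le> q v" if "v \<in> B" for v
      using lower[OF that, of 0] by (simp add: g_def)
    show "q' v \<le> q (\<lambda>x. v x + h x) - q h" if "v \<in> B" for v
      using lower[OF that, of 1] by (simp add: g_def)
  qed
qed

text \<open>Zorn's lemma, with the pointwise infimum of a chain as its bound. The infimum is finite
  on \<open>B\<close> because every sublinear \<open>a\<close> below \<open>p\<close> satisfies
  \<open>a v \<ge> - p (- v)\<close>.\<close>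

lemma minimal_sublinear_exists:
  fixes p :: "('a \<Rightarrow> real) \<Rightarrow> real"
  assumes B: "lin_subspace B" and p: "sublinear_on B p"
  obtains q where "sublinear_on B q" "\<And>v. v \<in> B \<Longrightarrow> q v \<le> p v"
    "\<forall>q'. sublinear_on B q' \<longrightarrow> (\<forall>v\<in>B. q' v \<le> q v) \<longrightarrow> (\<forall>v\<in>B. q v \<le> q' v)"
proof -
  \<comment> \<open>Values off \<open>B\<close> are normalised to 0, so comparing everywhere amounts
    to comparing on \<open>B\<close>. The order \<open>P\<close> is reversed: a maximal element for
    \<open>P\<close> is a minimal functional.\<close>
  define A where "A = {q. sublinear_on B q \<and> (\<forall>v\<in>B. q v \<le> p v) \<and> (\<forall>v. v \<notin> B \<longrightarrow> q v = 0)}"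
  define P where "P a b \<longleftrightarrow> (\<forall>v. b v \<le> a v)" for a b :: "('a \<Rightarrow> real) \<Rightarrow> real"
  have "partial_order_on A (relation_of P A)"
    by (rule partial_order_on_relation_ofI) (auto simp: P_def fun_eq_iff intro: order_trans antisym)
  moreover have "\<exists>u\<in>A. \<forall>a\<in>C. P a u" if C: "C \<in> Chains (relation_of P A)" for C
  proof (cases "C = {}")
    case True
    then show ?thesis
      using p by (intro bexI[of _ "\<lambda>v. if v \<in> B then p v else 0"])
        (auto simp: A_def sublinear_on_def lin_subspace_add[OF B] lin_subspace_scale[OF B])
  next
    case False
    have CA: "C \<subseteq> A"
      using C by (auto simp: Chains_def relation_of_def)
    have chain: "P a b \<or> P b a" if "a \<in> C" "b \<in> C" for a b
      using C that by (auto simp: Chains_def relation_of_def)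
    define u where "u v = (INF a\<in>C. a v)" for v
    have bdd: "bdd_below ((\<lambda>a. a v) ` C)" for v
    proof (cases "v \<in> B")
      case True
      show ?thesis
      proof (rule bdd_belowI2[of _ "- p (\<lambda>x. - 1 * v x)"])
        fix a assume "a \<in> C"
        then have a: "sublinear_on B a" "\<And>v. v \<in> B \<Longrightarrow> a v \<le> p v"
          using CA by (auto simp: A_def)
        have neg: "(\<lambda>x. - 1 * v x) \<in> B"
          using True by (rule lin_subspace_scale[OF B])
        have "0 \<le> a (\<lambda>x. v x + - 1 * v x)"
          using sublinear_on_zero[OF B a(1)] by simp
        also have "\<dots> \<le> a v + a (\<lambda>x. - 1 * v x)"
          by (rule sublinear_on_add[OF a(1) True neg])
        also have "\<dots> \<le> a v + p (\<lambda>x. - 1 * v x)"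
          using a(2)[OF neg] by simp
        finally show "- p (\<lambda>x. - 1 * v x) \<le> a v"
          by simp
      qed
    next
      case False
      then show ?thesis
        using CA by (intro bdd_belowI2[of _ 0]) (auto simp: A_def)
    qed
    have lower: "u v \<le> a v" if "a \<in> C" for a v
      unfolding u_def using that bdd by (intro cINF_lower) auto
    have greatest: "z \<le> u v" if "\<And>a. a \<in> C \<Longrightarrow> z \<le> a v" for z v
      unfolding u_def using that False by (intro cINF_greatest) auto
    have "sublinear_on B u"
      unfolding sublinear_on_def
    proof (intro conjI ballI allI impI)
      fix h k assume h: "h \<in> B" and k: "k \<in> B"
      \<comment> \<open>The smaller of \<open>a\<close> and \<open>b\<close> in the chain serves for
        both summands at once.\<close>
      have *: "u (\<lambda>x. h x + k x) \<le> a h + b k" if ab: "a \<in> C" "b \<in> C" for a b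
      proof -
        obtain c where c: "c \<in> C" "c h \<le> a h" "c k \<le> b k"
          using chain[OF ab] ab unfolding P_def by blast
        have "u (\<lambda>x. h x + k x) \<le> c (\<lambda>x. h x + k x)"
          by (rule lower[OF c(1)])
        also have "\<dots> \<le> c h + c k"
          using CA c(1) h k by (intro sublinear_on_add) (auto simp: A_def)
        finally show ?thesis
          using c by simp
      qed
      have "u (\<lambda>x. h x + k x) - a h \<le> u k" if "a \<in> C" for a
        using *[OF that] by (intro greatest) (simp add: algebra_simps)
      then have "u (\<lambda>x. h x + k x) - u k \<le> u h"
        by (intro greatest) (simp add: algebra_simps)
      then show "u (\<lambda>x. h x + k x) \<le> u h + u k"
        by simp
    next
      fix h and t :: real assume h: "h \<in> B" and t: "t > 0"
      have "u (\<lambda>x. t * h x) / t \<le> a h" if "a \<in> C" for a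
      proof -
        have "u (\<lambda>x. t * h x) \<le> a (\<lambda>x. t * h x)"
          by (rule lower[OF that])
        also have "\<dots> \<le> t * a h"
          using CA that h t by (intro sublinear_on_scale_le) (auto simp: A_def)
        finally show ?thesis
          using t by (simp add: field_simps)
      qed
      then have "u (\<lambda>x. t * h x) / t \<le> u h"
        by (rule greatest)
      then show "u (\<lambda>x. t * h x) \<le> t * u h"
        using t by (simp add: field_simps)
    qed
    moreover have "u v \<le> p v" if "v \<in> B" for v
    proof -
      obtain a where "a \<in> C"
        using False by blast
      moreover have "a v \<le> p v"
        using CA \<open>a \<in> C\<close> that by (auto simp: A_def)
      ultimately show ?thesis
        using lower[of a v] by simp
    qed
    moreover have "u v = 0" if "v \<notin> B" for v
    proof -
      have "a v = 0" if "a \<in> C" for a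
        using CA that \<open>v \<notin> B\<close> by (auto simp: A_def)
      then have "(\<lambda>a. a v) ` C = {0}"
        using False by force
      then show ?thesis
        by (simp add: u_def)
    qed
    ultimately have "u \<in> A"
      by (simp add: A_def)
    then show ?thesis
      using lower by (auto simp: P_def)
  qed
  ultimately obtain q where q: "q \<in> A" "\<And>a. a \<in> A \<Longrightarrow> P q a \<Longrightarrow> a = q"
    using predicate_Zorn[of A P] by blast
  show thesis
  proof
    show "q v \<le> p v" if "v \<in> B" for v
      using q(1) that by (auto simp: A_def)
  next
    show "sublinear_on B q"
      using q(1) by (auto simp: A_def)
    show "\<forall>q'. sublinear_on B q' \<longrightarrow> (\<forall>v\<in>B. q' v \<le> q v) \<longrightarrow> (\<forall>v\<in>B. q v \<le> q' v)"
    proof (intro allI impI ballI)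
      fix q' v assume q': "sublinear_on B q'" "\<forall>v\<in>B. q' v \<le> q v" "v \<in> B"
      define a where "a v = (if v \<in> B then q' v else 0)" for v
      have "sublinear_on B a"
        using q'(1) by (auto simp: a_def sublinear_on_def lin_subspace_add[OF B] lin_subspace_scale[OF B])
      moreover have "\<forall>v\<in>B. a v \<le> p v"
        using q'(2) q(1) by (fastforce simp: a_def A_def)
      moreover have "P q a"
        using q'(2) q(1) by (auto simp: P_def a_def A_def)
      ultimately have "a = q"
        by (intro q(2)) (auto simp: A_def a_def)
      then have "a v = q v"
        by simp
      then show "q v \<le> q' v"
        using q'(3) by (simp add: a_def)
    qed
  qed
qed

text \<open>Shifting \<open>p\<close> by \<open>f\<close> first ensures that any linear functional
  below \<open>p'\<close> attains \<open>p f\<close> at \<open>f\<close>, as its value at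
  \<open>- f\<close> shows. A minimal \<open>q\<close> below \<open>p'\<close> is additive, because
  shifting \<open>q\<close> by \<open>h\<close> yields a functional below \<open>q\<close>, which by
  minimality is not smaller than \<open>q\<close>.\<close>

theorem hahn_banach_sublinear:
  fixes p :: "('a \<Rightarrow> real) \<Rightarrow> real"
  assumes B: "lin_subspace B" and p: "sublinear_on B p" and f: "f \<in> B"
  obtains L where "linear_functional_on B L" "\<And>v. v \<in> B \<Longrightarrow> L v \<le> p v" "L f = p f"
proof -
  note neg = lin_subspace_scale[OF B, of _ "- 1"]
  obtain p' where p': "sublinear_on B p'" "\<And>v. v \<in> B \<Longrightarrow> p' v \<le> p v"
    "\<And>v. v \<in> B \<Longrightarrow> p' v \<le> p (\<lambda>x. v x + f x) - p f"
    by (rule sublinear_on_shift[OF B p f]) (rule that)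
  obtain q where q: "sublinear_on B q" "\<And>v. v \<in> B \<Longrightarrow> q v \<le> p' v"
    "\<forall>q'. sublinear_on B q' \<longrightarrow> (\<forall>v\<in>B. q' v \<le> q v) \<longrightarrow> (\<forall>v\<in>B. q v \<le> q' v)"
    by (rule minimal_sublinear_exists[OF B p'(1)]) (rule that)
  have q_add: "q (\<lambda>x. v x + h x) = q v + q h" if v: "v \<in> B" and h: "h \<in> B" for v h
  proof (rule antisym)
    show "q (\<lambda>x. v x + h x) \<le> q v + q h"
      by (rule sublinear_on_add[OF q(1) v h])
    obtain q' where q': "sublinear_on B q'" "\<And>v. v \<in> B \<Longrightarrow> q' v \<le> q v"
      "\<And>v. v \<in> B \<Longrightarrow> q' v \<le> q (\<lambda>x. v x + h x) - q h"
      by (rule sublinear_on_shift[OF B q(1) h]) (rule that)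
    show "q v + q h \<le> q (\<lambda>x. v x + h x)"
      using q(3)[rule_format, OF q'(1,2) v] q'(3)[OF v] by simp
  qed
  have q_neg: "q (\<lambda>x. - 1 * v x) = - q v" if "v \<in> B" for v
    using q_add[OF that neg[OF that]] sublinear_on_zero[OF B q(1)] by simp
  have q_scale: "q (\<lambda>x. c * v x) = c * q v" if v: "v \<in> B" for c v
  proof (cases "c \<ge> 0")
    case True
    then show ?thesis
      by (rule sublinear_on_scale[OF B q(1) v])
  next
    case False
    then have "q (\<lambda>x. - c * (- 1 * v x)) = - c * q (\<lambda>x. - 1 * v x)"
      using sublinear_on_scale[OF B q(1) neg[OF v], of "- c"] by simp
    then show ?thesis
      unfolding q_neg[OF v] by simp
  qed
  show thesis
  proof
    show "linear_functional_on B q"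
      using q_add q_scale by (simp add: linear_functional_on_def)
    show le: "q v \<le> p v" if "v \<in> B" for v
      using q(2) p'(2) that by (blast intro: order_trans)
    have "q (\<lambda>x. - 1 * f x) \<le> p (\<lambda>x. - 1 * f x + f x) - p f"
      using q(2) p'(3) neg[OF f] by (blast intro: order_trans)
    then have "p f \<le> q f"
      using q_neg[OF f] sublinear_on_zero[OF B p] by simp
    then show "q f = p f"
      using le[OF f] by simp
  qed
qed

section \<open>Sup norms and real parts\<close>

lemma norm_le_supnorm:
  assumes "bounded (f ` topspace X)" "x \<in> topspace X"
  shows "norm (f x) \<le> supnorm X f"
  unfolding supnorm_def
  using assms bdd_above_norm[of "f ` topspace X"] by (intro cSup_upper) (auto simp: image_image)

lemma supnorm_least:
  assumes "0 \<le> N" "\<And>x. x \<in> topspace X \<Longrightarrow> norm (f x) \<le> N"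
  shows "supnorm X f \<le> N"
  unfolding supnorm_def using assms by (intro cSup_least) auto

lemma supnorm_nonneg:
  assumes "bounded (f ` topspace X)"
  shows "0 \<le> supnorm X f"
  unfolding supnorm_def
  using assms bdd_above_norm[of "f ` topspace X"] by (intro cSup_upper) (auto simp: image_image)

lemma continuous_map_bounded:
  fixes f :: "'a \<Rightarrow> 'b::metric_space"
  assumes "compact_space X" "continuous_map X euclidean f"
  shows "bounded (f ` topspace X)"
  using image_compactin[of X "topspace X" euclidean f] assms
  by (auto simp: compact_space_def intro: compact_imp_bounded)

lemma Cfun_bounded: "\<lbrakk>compact_space X; f \<in> Cfun X\<rbrakk> \<Longrightarrow> bounded (f ` topspace X)"
  by (simp add: Cfun_def continuous_map_bounded)

lemma Cfun_diff: "\<lbrakk>f \<in> Cfun X; g \<in> Cfun X\<rbrakk> \<Longrightarrow> (\<lambda>x. f x - g x) \<in> Cfun X"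
  by (simp add: Cfun_def continuous_map_diff)

lemma lin_subspace_diff:
  assumes "lin_subspace A" "f \<in> A" "g \<in> A"
  shows "(\<lambda>x. f x - g x) \<in> A"
  using lin_subspace_add[OF assms(1,2) lin_subspace_scale[OF assms(1,3), of "- 1"]] by simp

lemma ex_unit_mult_eq_norm:
  fixes v :: "'k::real_normed_field"
  obtains c where "norm c = 1" "c * v = of_real (norm v)"
proof (cases "v = 0")
  case False
  then show ?thesis
    by (intro that[of "of_real (norm v) / v"]) (auto simp: norm_divide)
qed (use that[of 1] in auto)

context real_part
begin

lemma re_of_real [simp]: "re (of_real r) = r"
  using re_of_real_mult[of r 1] by (simp add: re_1)

lemma re_mult_of_real: "re (a * of_real r) = r * re a"
  using re_of_real_mult[of r a] by (simp add: mult.commute)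

lemma re_0 [simp]: "re 0 = 0"
  using re_of_real[of 0] by (simp del: re_of_real)

lemma re_minus: "re (- a) = - re a"
  using re_of_real_mult[of "- 1" a] by simp

lemma re_diff: "re (a - b) = re a - re b"
  using re_add[of a "- b"] by (simp add: re_minus)

lemma re_J [simp]: "re J = 0"
  using norm_power2[of 1] by (simp add: re_1)

lemma abs_re_le: "\<bar>re c\<bar> \<le> norm c"
  by (rule power2_le_imp_le) (simp_all add: norm_power2)

lemma norm_le_re: "norm c \<le> \<bar>re c\<bar> + \<bar>re (J * c)\<bar>"
  by (rule power2_le_imp_le) (simp_all add: norm_power2 power2_sum)

lemma eqI: "\<lbrakk>re a = re b; re (J * a) = re (J * b)\<rbrakk> \<Longrightarrow> a = b"
  by (metis decomp)

lemma J_J: "J * (J * c) = (if J = 0 then 0 else - c)"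
  using J_cases by (auto simp flip: mult.assoc)

lemma sconj_eq: "sconj c = of_real (2 * re c) - c"
proof (cases "c = 0")
  case False
  define a where "a = re c"
  define b where "b = re (J * c)"
  have c: "c = of_real a - J * of_real b"
    unfolding a_def b_def by (rule decomp)
  have "c * (of_real (2 * re c) - c) =
      (of_real a - J * of_real b) * (of_real a + J * of_real b)"
    unfolding a_def[symmetric] by (subst (1 2) c) (simp add: algebra_simps)
  also have "\<dots> = of_real (a\<^sup>2) - J * (J * of_real (b\<^sup>2))"
    by (simp add: power2_eq_square algebra_simps)
  also have "\<dots> = of_real ((norm c)\<^sup>2)"
    by (auto simp: J_J norm_power2 a_def b_def)
  finally show ?thesis
    using False by (simp add: sconj_def field_simps)
qed (simp add: sconj_def)

lemma continuous_map_re: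
  assumes "continuous_map X euclidean f"
  shows "continuous_map X euclideanreal (\<lambda>x. re (f x))"
proof -
  have "bounded_linear re"
  proof
    show "re (r *\<^sub>R a) = r *\<^sub>R re a" for r a
      by (simp add: scaleR_conv_of_real re_of_real_mult)
    show "\<exists>K. \<forall>x. norm (re x) \<le> norm x * K"
      using abs_re_le by (intro exI[of _ 1]) simp
  qed (rule re_add)
  then have "continuous_map euclidean euclideanreal re"
    by (simp add: linear_continuous_on)
  from continuous_map_compose[OF assms this] show ?thesis
    by (simp add: o_def)
qed

lemma tendsto_re: "(a \<longlongrightarrow> l) F \<Longrightarrow> ((\<lambda>n. re (a n)) \<longlongrightarrow> re l) F"
proof -
  assume "(a \<longlongrightarrow> l) F"
  then have "((\<lambda>n. a n - l) \<longlongrightarrow> 0) F"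
    by (simp add: LIM_zero)
  then have "((\<lambda>n. norm (a n - l)) \<longlongrightarrow> 0) F"
    by (rule tendsto_norm_zero)
  then have "((\<lambda>n. re (a n) - re l) \<longlongrightarrow> 0) F"
    by (rule Lim_null_comparison[rotated]) (simp add: abs_re_le flip: re_diff)
  then show ?thesis
    by (simp add: LIM_zero_iff)
qed

text \<open>For large \<open>R\<close> the disc of radius \<open>sqrt (R^2 + C^2)\<close> about \<open>- R\<close> approximates the left half plane.\<close>

lemma re_nonpos_of_norm_translates:
  assumes bound: "\<And>x. x \<in> D \<Longrightarrow> norm (k x) \<le> C" and neg: "\<And>x. x \<in> D \<Longrightarrow> re (k x) \<le> 0"
    and "0 \<le> C"
    and w: "\<And>R N. \<lbrakk>0 \<le> R; 0 \<le> N; \<And>x. x \<in> D \<Longrightarrow> norm (k x + of_real R) \<le> N\<rbrakk> \<Longrightarrow> norm (w + of_real R) \<le> N"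
  shows "re w \<le> 0"
proof (rule ccontr)
  assume "\<not> ?thesis"
  then have pos: "0 < re w"
    by simp
  \<comment> \<open>With this radius \<open>2 * re w * R\<close> alone already reaches the square of
    \<open>C\<close>, while \<open>R \<ge> C\<close> keeps \<open>re (k x) + R\<close> between 0 and
    \<open>R\<close>.\<close>
  define R where "R = C + C\<^sup>2 / (2 * re w)"
  have R: "C \<le> R"
    using pos by (simp add: R_def)
  have "norm (k x + of_real R) \<le> sqrt (R\<^sup>2 + C\<^sup>2)" if x: "x \<in> D" for x
  proof (rule real_le_rsqrt)
    have "(re (J * k x))\<^sup>2 \<le> (norm (k x))\<^sup>2"
      by (simp add: norm_power2)
    also have "\<dots> \<le> C\<^sup>2"
      using bound[OF x] by (simp add: power_mono)
    finally have "(re (J * k x))\<^sup>2 \<le> C\<^sup>2" .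
    moreover have "\<bar>re (k x)\<bar> \<le> R"
      using abs_re_le[of "k x"] bound[OF x] R by simp
    then have "(re (k x) + R)\<^sup>2 \<le> R\<^sup>2"
      using neg[OF x] by (intro power_mono) auto
    ultimately show "(norm (k x + of_real R))\<^sup>2 \<le> R\<^sup>2 + C\<^sup>2"
      by (simp add: norm_power2 re_add distrib_left re_mult_of_real)
  qed
  then have "norm (w + of_real R) \<le> sqrt (R\<^sup>2 + C\<^sup>2)"
    using R \<open>0 \<le> C\<close> by (intro w) auto
  then have "(norm (w + of_real R))\<^sup>2 \<le> R\<^sup>2 + C\<^sup>2"
    by (metis norm_ge_zero power_mono real_sqrt_pow2 sum_power2_ge_zero)
  then have "(re w + R)\<^sup>2 \<le> R\<^sup>2 + C\<^sup>2"
    by (simp add: norm_power2 re_add distrib_left re_mult_of_real) (smt (verit) zero_le_power2)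
  then have "(re w)\<^sup>2 + 2 * re w * R \<le> C\<^sup>2"
    by (simp add: power2_sum)
  moreover have "2 * re w * R = 2 * re w * C + C\<^sup>2"
    using pos by (simp add: R_def field_simps)
  moreover have "0 < (re w)\<^sup>2" "0 \<le> re w * C"
    using pos \<open>0 \<le> C\<close> by auto
  ultimately show False
    by linarith
qed

end

section \<open>Bounded real functions, the domain of the extended functionals\<close>

definition bounded_funs :: "'a set \<Rightarrow> ('a \<Rightarrow> real) set" where
  "bounded_funs D = {h. \<exists>N. \<forall>x\<in>D. \<bar>h x\<bar> \<le> N}"

lemma bounded_funsI: "(\<And>x. x \<in> D \<Longrightarrow> \<bar>h x\<bar> \<le> N) \<Longrightarrow> h \<in> bounded_funs D"
  by (auto simp: bounded_funs_def)

lemma bounded_funsE: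
  assumes "h \<in> bounded_funs D"
  obtains N where "0 < N" "\<And>x. x \<in> D \<Longrightarrow> \<bar>h x\<bar> \<le> N"
proof -
  obtain N where N: "\<forall>x\<in>D. \<bar>h x\<bar> \<le> N"
    using assms unfolding bounded_funs_def by blast
  show ?thesis
  proof (rule that[of "\<bar>N\<bar> + 1"])
    show "\<bar>h x\<bar> \<le> \<bar>N\<bar> + 1" if "x \<in> D" for x
      using N[rule_format, OF that] by simp
  qed simp
qed

lemma bounded_funs_const: "(\<lambda>x. c) \<in> bounded_funs D"
  by (rule bounded_funsI[of _ _ "\<bar>c\<bar>"]) simp

lemma bounded_funs_add:
  assumes "h \<in> bounded_funs D" "k \<in> bounded_funs D"
  shows "(\<lambda>x. h x + k x) \<in> bounded_funs D"
proof -
  obtain N M where "\<And>x. x \<in> D \<Longrightarrow> \<bar>h x\<bar> \<le> N" "\<And>x. x \<in> D \<Longrightarrow> \<bar>k x\<bar> \<le> M"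
    using assms by (metis bounded_funsE)
  then show ?thesis
    by (intro bounded_funsI[of _ _ "N + M"] order_trans[OF abs_triangle_ineq] add_mono)
qed

lemma bounded_funs_mult:
  assumes "h \<in> bounded_funs D" "k \<in> bounded_funs D"
  shows "(\<lambda>x. h x * k x) \<in> bounded_funs D"
proof -
  obtain N M where "0 < N" "\<And>x. x \<in> D \<Longrightarrow> \<bar>h x\<bar> \<le> N" "\<And>x. x \<in> D \<Longrightarrow> \<bar>k x\<bar> \<le> M"
    using assms by (metis bounded_funsE)
  then show ?thesis
    by (intro bounded_funsI[of _ _ "N * M"]) (simp add: abs_mult mult_mono)
qed

lemma bounded_funs_lin_subspace: "lin_subspace (bounded_funs D)"
  unfolding lin_subspace_def using bounded_funs_add bounded_funs_mult[OF bounded_funs_const] bounded_funs_const by fast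

lemma bounded_funs_diff: "\<lbrakk>h \<in> bounded_funs D; k \<in> bounded_funs D\<rbrakk> \<Longrightarrow> (\<lambda>x. h x - k x) \<in> bounded_funs D"
  by (rule lin_subspace_diff[OF bounded_funs_lin_subspace])

lemma bounded_funs_sum: "\<lbrakk>finite I; \<And>i. i \<in> I \<Longrightarrow> u i \<in> bounded_funs D\<rbrakk> \<Longrightarrow> (\<lambda>x. \<Sum>i\<in>I. u i x) \<in> bounded_funs D"
  by (induction I rule: finite_induct) (simp_all add: bounded_funs_const bounded_funs_add)

lemma continuous_map_bounded_funs:
  assumes "compact_space X" "continuous_map X euclideanreal f"
  shows "f \<in> bounded_funs (topspace X)"
  using continuous_map_bounded[OF assms] by (auto simp: bounded_iff bounded_funs_def)

section \<open>Extreme states and their upper envelopes\<close>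

section \<open>Extreme states\<close>

lemma linear_functional_on_add:
  "\<lbrakk>linear_functional_on A \<phi>; f \<in> A; g \<in> A; (\<lambda>x. f x + g x) \<in> A\<rbrakk> \<Longrightarrow> \<phi> (\<lambda>x. f x + g x) = \<phi> f + \<phi> g"
  unfolding linear_functional_on_def by blast

lemma linear_functional_on_scale:
  "\<lbrakk>linear_functional_on A \<phi>; f \<in> A; (\<lambda>x. c * f x) \<in> A\<rbrakk> \<Longrightarrow> \<phi> (\<lambda>x. c * f x) = c * \<phi> f"
  unfolding linear_functional_on_def by blast

lemma dual_ball_linear: "\<phi> \<in> dual_ball Z A \<Longrightarrow> linear_functional_on A \<phi>"
  unfolding dual_ball_def by blast

lemma dual_ball_norm: "\<lbrakk>\<phi> \<in> dual_ball Z A; g \<in> A\<rbrakk> \<Longrightarrow> norm (\<phi> g) \<le> supnorm Z g"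
  unfolding dual_ball_def by blast

text \<open>Instantiated later with \<open>\<phi> g = Tinf g y\<close> for a Choquet boundary point
  \<open>y\<close>, so that extremality can be exploited on \<open>X\<close>.\<close>

locale extreme_state = real_part re J
  for re :: "'k::real_normed_field \<Rightarrow> real" and J :: 'k +
  fixes X :: "'a topology" and S :: "('a \<Rightarrow> 'k) set" and \<phi> :: "('a \<Rightarrow> 'k) \<Rightarrow> 'k"
  assumes compact: "compact_space X"
    and S: "function_space X S"
    and \<phi>: "\<phi> \<in> dual_ball X S"
    and \<phi>_one: "\<phi> (\<lambda>x. if x \<in> topspace X then 1 else 0) = 1"
    and extreme: "\<lbrakk>\<phi>1 \<in> dual_ball X S; \<phi>2 \<in> dual_ball X S; 0 < t; t < 1;
        \<And>g. g \<in> S \<Longrightarrow> \<phi> g = of_real t * \<phi>1 g + of_real (1 - t) * \<phi>2 g; g \<in> S\<rbrakk> \<Longrightarrow> \<phi>1 g = \<phi>2 g"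
begin

definition one :: "'a \<Rightarrow> 'k" where
  "one = (\<lambda>x. if x \<in> topspace X then 1 else 0)"

lemma one_in: "one \<in> S"
  using S by (simp add: one_def function_space_def)

lemma S_lin: "lin_subspace S"
  using S by (simp add: function_space_def)

lemma S_Cfun: "g \<in> S \<Longrightarrow> g \<in> Cfun X"
  using S by (auto simp: function_space_def)

lemmas S_zero = lin_subspace_zero[OF S_lin]
  and S_add = lin_subspace_add[OF S_lin]
  and S_diff = lin_subspace_diff[OF S_lin]
  and S_scale = lin_subspace_scale[OF S_lin]

lemma \<phi>_add: "\<lbrakk>f \<in> S; g \<in> S\<rbrakk> \<Longrightarrow> \<phi> (\<lambda>x. f x + g x) = \<phi> f + \<phi> g"
  by (intro linear_functional_on_add[of S] dual_ball_linear[OF \<phi>] S_add)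

lemma \<phi>_scale: "g \<in> S \<Longrightarrow> \<phi> (\<lambda>x. c * g x) = c * \<phi> g"
  by (intro linear_functional_on_scale[of S] dual_ball_linear[OF \<phi>] S_scale)

lemma \<phi>_diff:
  assumes "f \<in> S" "g \<in> S"
  shows "\<phi> (\<lambda>x. f x - g x) = \<phi> f - \<phi> g"
  using \<phi>_add[OF assms(1) S_scale[OF assms(2), of "- 1"]] \<phi>_scale[OF assms(2), of "- 1"] by simp

lemma \<phi>_zero: "\<phi> (\<lambda>x. 0) = 0"
  using \<phi>_scale[OF S_zero, of 0] by simp

lemma S_bounded: "g \<in> S \<Longrightarrow> bounded (g ` topspace X)"
  by (rule Cfun_bounded[OF compact S_Cfun])

lemma S_re_bounded_funs: "g \<in> S \<Longrightarrow> (\<lambda>x. re (g x)) \<in> bounded_funs (topspace X)"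
  using S_Cfun by (intro continuous_map_bounded_funs[OF compact] continuous_map_re) (simp add: Cfun_def)

text \<open>The number \<open>v\<close> stands for the value at \<open>f\<close> of a map known only
  through its distances to the values of \<open>\<phi>\<close> on \<open>S\<close>. Subtracting the
  constant \<open>R\<close> from \<open>g\<close> turns these distances into the translate bounds of
  \<open>re_nonpos_of_norm_translates\<close>, with \<open>k = f - g\<close> and
  \<open>w = v - \<phi> g\<close>.\<close>

lemma re_le_of_dominated:
  assumes f: "f \<in> Cfun X" and v: "\<And>g. g \<in> S \<Longrightarrow> norm (v - \<phi> g) \<le> supnorm X (\<lambda>x. f x - g x)"
    and g: "g \<in> S" and le: "\<And>x. x \<in> topspace X \<Longrightarrow> re (f x) \<le> re (g x)"
  shows "re v \<le> re (\<phi> g)"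
proof -
  have bdd: "bounded ((\<lambda>x. f x - g x) ` topspace X)"
    by (intro Cfun_bounded compact Cfun_diff f S_Cfun g)
  have "re (v - \<phi> g) \<le> 0"
  proof (rule re_nonpos_of_norm_translates[OF norm_le_supnorm[OF bdd] _ supnorm_nonneg[OF bdd]])
    fix R N :: real
    assume N: "0 \<le> N" "\<And>x. x \<in> topspace X \<Longrightarrow> norm (f x - g x + of_real R) \<le> N"
    define g' where "g' = (\<lambda>x. g x - of_real R * one x)"
    have g': "g' \<in> S"
      unfolding g'_def by (intro S_diff S_scale one_in g)
    have phi_g': "\<phi> g' = \<phi> g - of_real R"
      unfolding g'_def \<phi>_diff[OF g S_scale[OF one_in]] \<phi>_scale[OF one_in]
      using \<phi>_one by (simp add: one_def)
    have "norm (v - \<phi> g + of_real R) = norm (v - \<phi> g')"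
      unfolding phi_g' by (simp add: algebra_simps)
    also have "\<dots> \<le> supnorm X (\<lambda>x. f x - g' x)"
      by (rule v[OF g'])
    also have "\<dots> \<le> N"
      using N by (intro supnorm_least) (auto simp: g'_def one_def algebra_simps)
    finally show "norm (v - \<phi> g + of_real R) \<le> N" .
  qed (use le in \<open>auto simp: re_diff\<close>)
  then show ?thesis
    by (simp add: re_diff)
qed

text \<open>A functional of norm at most 1 taking the value 1 at the constant 1 is positive: the
  preceding lemma applies with \<open>v = \<phi> f\<close>.\<close>

lemma \<phi>_mono:
  assumes "f \<in> S" "g \<in> S" "\<And>x. x \<in> topspace X \<Longrightarrow> re (f x) \<le> re (g x)"
  shows "re (\<phi> f) \<le> re (\<phi> g)"
proof (rule re_le_of_dominated[OF S_Cfun[OF assms(1)] _ assms(2,3)])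
  show "norm (\<phi> f - \<phi> g) \<le> supnorm X (\<lambda>x. f x - g x)" if "g \<in> S" for g
    using dual_ball_norm[OF \<phi> S_diff[OF assms(1) that]] by (simp only: \<phi>_diff[OF assms(1) that])
qed

text \<open>The upper envelope of \<open>h\<close> with respect to \<open>S\<close>, evaluated by
  \<open>\<phi>\<close>. A linear functional below it is automatically positive and extends the real
  part of \<open>\<phi>\<close> (\<open>L_mono\<close>, \<open>L_re\<close>).\<close>

definition upper :: "('a \<Rightarrow> real) \<Rightarrow> real" where
  "upper h = Inf ((\<lambda>g. re (\<phi> g)) ` {g \<in> S. \<forall>x\<in>topspace X. h x \<le> re (g x)})"

lemma upper_bdd_below:
  assumes "h \<in> bounded_funs (topspace X)"
  shows "bdd_below ((\<lambda>g. re (\<phi> g)) ` {g \<in> S. \<forall>x\<in>topspace X. h x \<le> re (g x)})"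
proof -
  obtain N where N: "0 < N" "\<And>x. x \<in> topspace X \<Longrightarrow> \<bar>h x\<bar> \<le> N"
    using assms by (rule bounded_funsE) (rule that)
  show ?thesis
  proof (rule bdd_belowI2)
    fix g assume g: "g \<in> {g \<in> S. \<forall>x\<in>topspace X. h x \<le> re (g x)}"
    show "re (\<phi> (\<lambda>x. of_real (- N) * one x)) \<le> re (\<phi> g)"
    proof (rule \<phi>_mono)
      fix x assume x: "x \<in> topspace X"
      have "- N \<le> h x" "h x \<le> re (g x)"
        using N(2)[OF x] g x by auto
      then show "re (of_real (- N) * one x) \<le> re (g x)"
        using x by (simp only: re_of_real_mult) (simp add: one_def re_1)
    qed (use g in \<open>blast intro: S_scale one_in\<close>)+
  qed
qed

lemma upper_le:
  "\<lbrakk>h \<in> bounded_funs (topspace X); g \<in> S; \<And>x. x \<in> topspace X \<Longrightarrow> h x \<le> re (g x)\<rbrakk> \<Longrightarrow> upper h \<le> re (\<phi> g)"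
  unfolding upper_def by (intro cInf_lower upper_bdd_below) auto

lemma upper_greatest:
  assumes "h \<in> bounded_funs (topspace X)"
    "\<And>g. \<lbrakk>g \<in> S; \<forall>x\<in>topspace X. h x \<le> re (g x)\<rbrakk> \<Longrightarrow> z \<le> re (\<phi> g)"
  shows "z \<le> upper h"
  unfolding upper_def
proof (rule cInf_greatest)
  obtain N where N: "0 < N" "\<And>x. x \<in> topspace X \<Longrightarrow> \<bar>h x\<bar> \<le> N"
    using assms(1) by (rule bounded_funsE) (rule that)
  have "h x \<le> re (of_real N * one x)" if "x \<in> topspace X" for x
    using N(2)[OF that] that by (simp only: re_of_real_mult) (simp add: one_def re_1)
  then show "(\<lambda>g. re (\<phi> g)) ` {g \<in> S. \<forall>x\<in>topspace X. h x \<le> re (g x)} \<noteq> {}"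
    using S_scale[OF one_in, of "of_real N"] by blast
qed (use assms(2) in auto)

lemma upper_sublinear: "sublinear_on (bounded_funs (topspace X)) upper"
  unfolding sublinear_on_def
proof (intro conjI ballI allI impI)
  fix h k assume h: "h \<in> bounded_funs (topspace X)" and k: "k \<in> bounded_funs (topspace X)"
  have *: "upper (\<lambda>x. h x + k x) \<le> re (\<phi> f) + re (\<phi> g)"
    if f: "f \<in> S" "\<forall>x\<in>topspace X. h x \<le> re (f x)" and g: "g \<in> S" "\<forall>x\<in>topspace X. k x \<le> re (g x)" for f g
    using upper_le[OF bounded_funs_add[OF h k] S_add[OF f(1) g(1)]] f g
    by (simp add: \<phi>_add re_add add_mono)
  have "upper (\<lambda>x. h x + k x) - re (\<phi> f) \<le> upper k"
    if "f \<in> S" "\<forall>x\<in>topspace X. h x \<le> re (f x)" for f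
    using *[OF that] by (intro upper_greatest[OF k]) (simp add: algebra_simps)
  then have "upper (\<lambda>x. h x + k x) - upper k \<le> upper h"
    by (intro upper_greatest[OF h]) (simp add: algebra_simps)
  then show "upper (\<lambda>x. h x + k x) \<le> upper h + upper k"
    by simp
next
  fix h and t :: real assume h: "h \<in> bounded_funs (topspace X)" and t: "0 < t"
  have "upper (\<lambda>x. t * h x) / t \<le> re (\<phi> g)" if g: "g \<in> S" "\<forall>x\<in>topspace X. h x \<le> re (g x)" for g
    using upper_le[OF bounded_funs_mult[OF bounded_funs_const h] S_scale[OF g(1)], of t "of_real t"] g t
    by (simp add: \<phi>_scale re_of_real_mult field_simps)
  then have "upper (\<lambda>x. t * h x) / t \<le> upper h"
    by (rule upper_greatest[OF h])
  then show "upper (\<lambda>x. t * h x) \<le> t * upper h"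
    using t by (simp add: field_simps)
qed

end

section \<open>Multiplicativity of positive extensions of an extreme state\<close>

locale positive_extension = extreme_state re J X S \<phi>
  for re :: "'k::real_normed_field \<Rightarrow> real" and J :: 'k
    and X :: "'a topology" and S :: "('a \<Rightarrow> 'k) set" and \<phi> :: "('a \<Rightarrow> 'k) \<Rightarrow> 'k" +
  fixes L :: "('a \<Rightarrow> real) \<Rightarrow> real"
  assumes L_linear: "linear_functional_on (bounded_funs (topspace X)) L"
    and L_upper: "h \<in> bounded_funs (topspace X) \<Longrightarrow> L h \<le> upper h"
begin

abbreviation "B \<equiv> bounded_funs (topspace X)"

lemma L_add: "\<lbrakk>h \<in> B; k \<in> B\<rbrakk> \<Longrightarrow> L (\<lambda>x. h x + k x) = L h + L k"
  by (intro linear_functional_on_add[OF L_linear] bounded_funs_add)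

lemma L_scale: "h \<in> B \<Longrightarrow> L (\<lambda>x. c * h x) = c * L h"
  by (intro linear_functional_on_scale[OF L_linear] bounded_funs_mult bounded_funs_const)

lemma L_diff:
  assumes "h \<in> B" "k \<in> B"
  shows "L (\<lambda>x. h x - k x) = L h - L k"
  using L_add[OF assms(1) bounded_funs_mult[OF bounded_funs_const assms(2)], of "- 1"]
    L_scale[OF assms(2), of "- 1"] by simp

text \<open>The zero function belongs to \<open>S\<close> and dominates \<open>h - k\<close>, so the
  envelope of \<open>h - k\<close> is at most 0.\<close>

lemma L_mono:
  assumes "h \<in> B" "k \<in> B" "\<And>x. x \<in> topspace X \<Longrightarrow> h x \<le> k x"
  shows "L h \<le> L k"
proof -
  have "L (\<lambda>x. h x - k x) \<le> re (\<phi> (\<lambda>x. 0))"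
    using assms by (intro order_trans[OF L_upper upper_le] bounded_funs_diff S_zero) auto
  then show ?thesis
    using L_diff[OF assms(1,2)] by (simp add: \<phi>_zero)
qed

lemma L_cong: "\<lbrakk>h \<in> B; k \<in> B; \<And>x. x \<in> topspace X \<Longrightarrow> h x = k x\<rbrakk> \<Longrightarrow> L h = L k"
  by (intro antisym L_mono) auto

lemma L_re:
  assumes g: "g \<in> S"
  shows "L (\<lambda>x. re (g x)) = re (\<phi> g)"
proof (rule antisym)
  have "L (\<lambda>x. re (h x)) \<le> re (\<phi> h)" if "h \<in> S" for h
    using that by (intro order_trans[OF L_upper upper_le] S_re_bounded_funs) auto
  from this[OF g] this[OF S_scale[OF g, of "- 1"]]
  show "L (\<lambda>x. re (g x)) \<le> re (\<phi> g)" "re (\<phi> g) \<le> L (\<lambda>x. re (g x))"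
    using \<phi>_scale[OF g, of "- 1"] L_scale[OF S_re_bounded_funs[OF g], of "- 1"] by (auto simp: re_minus)
qed

lemma L_const: "L (\<lambda>x. c) = c"
proof -
  have "L (\<lambda>x. c) = L (\<lambda>x. re (of_real c * one x))"
    by (intro L_cong bounded_funs_const S_re_bounded_funs S_scale one_in) (simp add: one_def)
  also have "\<dots> = c"
    using L_re[OF S_scale[OF one_in]] \<phi>_scale[OF one_in] \<phi>_one by (simp add: one_def)
  finally show ?thesis .
qed

text \<open>The complexification of \<open>L\<close>, modelled on \<open>decomp\<close>; for
  \<open>J = 0\<close> it is just \<open>L\<close> of the real part.\<close>

definition Lc :: "('a \<Rightarrow> 'k) \<Rightarrow> 'k" where
  "Lc k = of_real (L (\<lambda>x. re (k x))) - J * of_real (L (\<lambda>x. re (J * k x)))"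

text \<open>In effect the bounded scalar functions, phrased so that closure under scalar multiples
  is immediate.\<close>

definition BK :: "('a \<Rightarrow> 'k) set" where
  "BK = {k. \<forall>c. (\<lambda>x. re (c * k x)) \<in> B}"

lemma BK_D: "k \<in> BK \<Longrightarrow> (\<lambda>x. re (k x)) \<in> B" "k \<in> BK \<Longrightarrow> (\<lambda>x. re (c * k x)) \<in> B"
  by (auto simp: BK_def dest: spec[of _ 1])

lemma BK_scale: "k \<in> BK \<Longrightarrow> (\<lambda>x. c * k x) \<in> BK"
  by (simp add: BK_def flip: mult.assoc)

lemma BK_weight:
  assumes "w \<in> B" "g \<in> S"
  shows "(\<lambda>x. of_real (w x) * g x) \<in> BK"
proof -
  have "re (c * (of_real (w x) * g x)) = w x * re (c * g x)" for c x
    using re_of_real_mult[of "w x" "c * g x"] by (simp add: mult.left_commute)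
  then show ?thesis
    unfolding BK_def using bounded_funs_mult[OF assms(1) S_re_bounded_funs[OF S_scale[OF assms(2)]]] by simp
qed

lemma re_Lc: "re (Lc k) = L (\<lambda>x. re (k x))"
  by (simp add: Lc_def re_diff re_mult_of_real)

lemma Lc_add:
  assumes "k \<in> BK" "l \<in> BK"
  shows "Lc (\<lambda>x. k x + l x) = Lc k + Lc l"
  using L_add[OF BK_D(1)[OF assms(1)] BK_D(1)[OF assms(2)]]
    L_add[OF BK_D(2)[OF assms(1), of J] BK_D(2)[OF assms(2), of J]]
  by (simp add: Lc_def re_add distrib_left algebra_simps)

lemma Lc_scale:
  assumes k: "k \<in> BK"
  shows "Lc (\<lambda>x. c * k x) = c * Lc k"
proof -
  have real: "Lc (\<lambda>x. of_real r * k x) = of_real r * Lc k" if k: "k \<in> BK" for r k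
  proof -
    have "re (J * (of_real r * k x)) = r * re (J * k x)" for x
      using re_of_real_mult[of r "J * k x"] by (simp add: mult.left_commute)
    then show ?thesis
      using L_scale[OF BK_D(1)[OF k], of r] L_scale[OF BK_D(2)[OF k], of r J]
      by (simp add: Lc_def re_of_real_mult algebra_simps)
  qed
  have imag: "Lc (\<lambda>x. J * k x) = J * Lc k"
  proof (cases "J = 0")
    case True
    then show ?thesis
      unfolding Lc_def by (simp add: L_const)
  next
    case False
    have "L (\<lambda>x. re (J * (J * k x))) = - L (\<lambda>x. re (k x))"
      using False L_scale[OF BK_D(1)[OF k], of "- 1"] by (simp add: J_J re_minus)
    then show ?thesis
      using False by (simp add: Lc_def right_diff_distrib J_J)
  qed
  define a b where "a = re c" and "b = re (J * c)"
  have c: "c = of_real a + of_real (- b) * J"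
    using decomp[of c] by (simp add: a_def b_def mult.commute)
  have "Lc (\<lambda>x. c * k x) = Lc (\<lambda>x. of_real a * k x + of_real (- b) * (J * k x))"
    unfolding c by (simp add: algebra_simps)
  also have "\<dots> = of_real a * Lc k + of_real (- b) * Lc (\<lambda>x. J * k x)"
    by (simp only: Lc_add[OF BK_scale[OF k] BK_scale[OF BK_scale[OF k]]] real[OF k]
        real[OF BK_scale[OF k]])
  also have "\<dots> = c * Lc k"
    unfolding c imag by (simp add: algebra_simps)
  finally show ?thesis .
qed

text \<open>A unimodular factor \<open>c\<close> rotates the value onto its norm; then positivity of
  \<open>L\<close> applies, since \<open>re (c * g x)\<close> is at most the sup norm of
  \<open>g\<close>.\<close>

lemma norm_Lc_weight_le:
  assumes w: "w \<in> B" "\<And>x. x \<in> topspace X \<Longrightarrow> 0 \<le> w x" and g: "g \<in> S"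
  shows "norm (Lc (\<lambda>x. of_real (w x) * g x)) \<le> L w * supnorm X g"
proof -
  let ?k = "\<lambda>x. of_real (w x) * g x"
  obtain c where c: "norm c = 1" "c * Lc ?k = of_real (norm (Lc ?k))"
    by (rule ex_unit_mult_eq_norm)
  have "norm (Lc ?k) = re (Lc (\<lambda>x. c * ?k x))"
    using c(2) Lc_scale[OF BK_weight[OF w(1) g], of c] by simp
  also have "\<dots> = L (\<lambda>x. re (c * ?k x))"
    by (rule re_Lc)
  also have "\<dots> \<le> L (\<lambda>x. supnorm X g * w x)"
  proof (rule L_mono)
    show "(\<lambda>x. re (c * ?k x)) \<in> B"
      by (rule BK_D(2)[OF BK_weight[OF w(1) g]])
    show "(\<lambda>x. supnorm X g * w x) \<in> B"
      by (intro bounded_funs_mult bounded_funs_const w)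
    fix x assume x: "x \<in> topspace X"
    have eq: "re (c * ?k x) = w x * re (c * g x)"
      using re_of_real_mult[of "w x" "c * g x"] by (simp add: mult.left_commute)
    have le: "re (c * g x) \<le> supnorm X g"
      using abs_re_le[of "c * g x"] norm_le_supnorm[OF S_bounded[OF g] x] c(1)
      by (simp add: norm_mult)
    show "re (c * ?k x) \<le> supnorm X g * w x"
      unfolding eq using mult_left_mono[OF le w(2)[OF x]] by (simp add: mult.commute)
  qed
  also have "\<dots> = L w * supnorm X g"
    using L_scale[OF w(1)] by simp
  finally show ?thesis .
qed

lemma weight_in_dual_ball:
  assumes w: "w \<in> B" "\<And>x. x \<in> topspace X \<Longrightarrow> 0 \<le> w x" and pos: "0 < L w"
  shows "(\<lambda>g. Lc (\<lambda>x. of_real (w x) * g x) / of_real (L w)) \<in> dual_ball X S"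
  unfolding dual_ball_def linear_functional_on_def mem_Collect_eq
proof (intro conjI ballI allI impI)
  fix f g assume fg: "f \<in> S" "g \<in> S"
  show "Lc (\<lambda>x. of_real (w x) * (f x + g x)) / of_real (L w) =
      Lc (\<lambda>x. of_real (w x) * f x) / of_real (L w) + Lc (\<lambda>x. of_real (w x) * g x) / of_real (L w)"
    using Lc_add[OF BK_weight[OF w(1) fg(1)] BK_weight[OF w(1) fg(2)]]
    by (simp add: distrib_left add_divide_distrib)
next
  fix g c assume g: "g \<in> S"
  show "Lc (\<lambda>x. of_real (w x) * (c * g x)) / of_real (L w) =
      c * (Lc (\<lambda>x. of_real (w x) * g x) / of_real (L w))"
    using Lc_scale[OF BK_weight[OF w(1) g], of c] by (simp add: mult.left_commute)
next
  fix g assume g: "g \<in> S"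
  show "norm (Lc (\<lambda>x. of_real (w x) * g x) / of_real (L w)) \<le> supnorm X g"
    using norm_Lc_weight_le[OF w g] pos by (simp add: norm_divide field_simps)
qed

text \<open>For a weight \<open>0 < w < 1\<close> the functional \<open>\<phi>\<close> is a convex combination of the normalised functionals
  \<open>Lc (w \<cdot>)\<close> and \<open>Lc ((1 - w) \<cdot>)\<close>, which by extremality are both equal to \<open>\<phi>\<close>. Hence \<open>L\<close> is multiplicative
  as soon as one factor is the real part of an element of \<open>S\<close>.\<close>

lemma L_mult_re:
  assumes h: "h \<in> B" and g: "g \<in> S"
  shows "L (\<lambda>x. h x * re (g x)) = L h * re (\<phi> g)"
proof -
  obtain N where N: "0 < N" "\<And>x. x \<in> topspace X \<Longrightarrow> \<bar>h x\<bar> \<le> N"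
    using h by (rule bounded_funsE) (rule that)
  \<comment> \<open>The scale keeps \<open>w\<close> between 1/4 and 3/4, so that \<open>w\<close>
    and \<open>1 - w\<close> are both nonnegative weights with positive \<open>L\<close>-mass and
    can be normalised.\<close>
  define d where "d = 1 / (4 * N)"
  define w where "w = (\<lambda>x. 1/2 + d * h x)"
  define w' where "w' = (\<lambda>x. 1 - w x)"
  have d: "0 < d" "d * N = 1/4"
    using N(1) by (auto simp: d_def)
  have w: "w \<in> B" and w': "w' \<in> B"
    unfolding w_def w'_def by (intro bounded_funs_add bounded_funs_diff bounded_funs_mult bounded_funs_const h)+
  have range: "1/4 \<le> w x" "w x \<le> 3/4" if "x \<in> topspace X" for x
  proof -
    have "\<bar>d * h x\<bar> \<le> d * N"
      using N(2)[OF that] d(1) by (simp add: abs_mult)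
    then show "1/4 \<le> w x" "w x \<le> 3/4"
      unfolding d(2) by (auto simp: w_def)
  qed
  have Lw: "1/4 \<le> L w" "L w \<le> 3/4"
    using L_mono[OF bounded_funs_const w range(1)] L_mono[OF w bounded_funs_const range(2)] by (simp_all add: L_const)
  have Lw': "L w' = 1 - L w"
    unfolding w'_def using L_diff[OF bounded_funs_const w] by (simp add: L_const)
  define \<psi> where "\<psi> w g = Lc (\<lambda>x. of_real (w x) * g x) / of_real (L w)" for w g
  have split: "\<phi> g = of_real (L w) * \<psi> w g + of_real (1 - L w) * \<psi> w' g" if g: "g \<in> S" for g
  proof -
    have "of_real (L w) * \<psi> w g + of_real (1 - L w) * \<psi> w' g =
        Lc (\<lambda>x. of_real (w x) * g x) + Lc (\<lambda>x. of_real (w' x) * g x)"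
      using Lw unfolding \<psi>_def Lw'[symmetric] by (simp add: Lw')
    also have "\<dots> = Lc (\<lambda>x. of_real (w x) * g x + of_real (w' x) * g x)"
      by (rule Lc_add[symmetric]) (intro BK_weight w w' g)+
    also have "\<dots> = Lc g"
      by (simp add: w'_def algebra_simps)
    also have "\<dots> = \<phi> g"
      using decomp[of "\<phi> g"] L_re[OF g] L_re[OF S_scale[OF g, of J]] \<phi>_scale[OF g, of J]
      by (simp add: Lc_def)
    finally show ?thesis
      by simp
  qed
  have "\<psi> w g = \<psi> w' g"
  proof (rule extreme[OF _ _ _ _ split g])
    show "\<psi> w \<in> dual_ball X S" "\<psi> w' \<in> dual_ball X S"
      unfolding \<psi>_def
    proof (rule_tac [!] weight_in_dual_ball)
      fix x assume x: "x \<in> topspace X"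
      show "0 \<le> w x" "0 \<le> w' x"
        using range[OF x] by (simp_all add: w'_def)
    qed (use w w' Lw Lw' in auto)
  qed (use Lw in auto)
  then have "\<psi> w g = \<phi> g"
    using split[OF g] by (simp add: algebra_simps)
  then have "Lc (\<lambda>x. of_real (w x) * g x) = of_real (L w) * \<phi> g"
    using Lw by (auto simp: \<psi>_def field_simps)
  then have "L (\<lambda>x. re (of_real (w x) * g x)) = L w * re (\<phi> g)"
    using re_Lc by (metis re_of_real_mult)
  \<comment> \<open>Multiplicativity passes from \<open>w\<close> to \<open>h\<close>: the
    contribution of the constant 1/2 cancels by \<open>L_re\<close>, and \<open>d > 0\<close> can be
    divided out.\<close>
  moreover have "(\<lambda>x. re (of_real (w x) * g x)) = (\<lambda>x. 1/2 * re (g x) + d * (h x * re (g x)))"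
    unfolding re_of_real_mult w_def by (simp add: algebra_simps)
  ultimately have "L (\<lambda>x. 1/2 * re (g x) + d * (h x * re (g x))) = L w * re (\<phi> g)"
    by (simp only:)
  moreover have "L w = 1/2 + d * L h"
    unfolding w_def using L_add[OF bounded_funs_const bounded_funs_mult[OF bounded_funs_const h]] L_scale[OF h]
    by (simp add: L_const)
  moreover have "L (\<lambda>x. 1/2 * re (g x) + d * (h x * re (g x))) =
      1/2 * re (\<phi> g) + d * L (\<lambda>x. h x * re (g x))"
    using L_add[OF bounded_funs_mult[OF bounded_funs_const S_re_bounded_funs[OF g]]
        bounded_funs_mult[OF bounded_funs_const bounded_funs_mult[OF h S_re_bounded_funs[OF g]]], of "1/2" d]
      L_scale[OF S_re_bounded_funs[OF g], of "1/2"] L_scale[OF bounded_funs_mult[OF h S_re_bounded_funs[OF g]], of d] L_re[OF g]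
    by simp
  ultimately show ?thesis
    using d(1) by (simp add: algebra_simps)
qed

section \<open>Vanishing variances and the representing point\<close>

definition dev :: "('a \<Rightarrow> 'k) \<Rightarrow> 'a \<Rightarrow> real" where
  "dev g x = (re (g x) - re (\<phi> g))\<^sup>2"

lemma dev_bounded_funs: "g \<in> S \<Longrightarrow> dev g \<in> B"
  unfolding dev_def power2_eq_square by (intro bounded_funs_mult bounded_funs_diff bounded_funs_const S_re_bounded_funs)

text \<open>The variance of \<open>re g\<close> under \<open>L\<close>: multiplicativity with the
  factor \<open>h = re g - re (\<phi> g)\<close> cancels the two terms of the product
  \<open>h * h\<close>.\<close>

lemma L_dev:
  assumes g: "g \<in> S"
  shows "L (dev g) = 0"
proof -
  define h where "h = (\<lambda>x. re (g x) - re (\<phi> g))"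
  have h: "h \<in> B"
    unfolding h_def by (intro bounded_funs_diff bounded_funs_const S_re_bounded_funs g)
  have "L (\<lambda>x. h x * re (g x) - re (\<phi> g) * h x) = 0"
    using L_diff[OF bounded_funs_mult[OF h S_re_bounded_funs[OF g]] bounded_funs_mult[OF bounded_funs_const h]]
      L_mult_re[OF h g] L_scale[OF h] by simp
  then show ?thesis
    by (simp add: dev_def[abs_def] h_def power2_eq_square algebra_simps)
qed

lemma dev_scale: "g \<in> S \<Longrightarrow> dev (\<lambda>x. of_real r * g x) x = r\<^sup>2 * dev g x"
  by (simp add: dev_def \<phi>_scale re_of_real_mult power_mult_distrib flip: right_diff_distrib)

lemma dev_large:
  assumes "g \<in> S" "dev g x \<noteq> 0"
  shows "\<exists>g'\<in>S. N < dev g' x"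
proof
  have pos: "0 < dev g x"
    using assms(2) by (simp add: dev_def)
  \<comment> \<open>Since \<open>dev\<close> is quadratic in \<open>g\<close>, this multiple of
    \<open>g\<close> has deviation \<open>\<bar>N\<bar> + 1\<close> at \<open>x\<close>.\<close>
  define r where "r = sqrt ((\<bar>N\<bar> + 1) / dev g x)"
  have "dev (\<lambda>x. of_real r * g x) x = \<bar>N\<bar> + 1"
    using pos unfolding dev_scale[OF assms(1)] r_def by simp
  then show "N < dev (\<lambda>x. of_real r * g x) x"
    by simp
qed (rule S_scale[OF assms(1)])

text \<open>By compactness finitely many of the strict inequalities cover \<open>X\<close>. As
  deviations are nonnegative, their finite sum dominates \<open>h\<close>, and \<open>L\<close>
  annihilates that sum.\<close>

lemma L_nonpos:
  assumes h: "continuous_map X euclideanreal h"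
    and less: "\<And>x. x \<in> topspace X \<Longrightarrow> \<exists>g\<in>S. h x < dev g x"
  shows "L h \<le> 0"
proof -
  obtain G where G: "\<And>x. x \<in> topspace X \<Longrightarrow> G x \<in> S \<and> h x < dev (G x) x"
    using less by metis
  define U where "U x = {z \<in> topspace X. h z < dev (G x) z}" for x
  have "openin X (U x)" if x: "x \<in> topspace X" for x
  proof -
    have "continuous_map X euclideanreal (\<lambda>z. dev (G x) z - h z)"
      unfolding dev_def using G[OF x] S_Cfun
      by (intro continuous_intros continuous_map_re h) (auto simp: Cfun_def)
    from openin_continuous_map_preimage[OF this, of "{0<..}"] show ?thesis
      by (simp add: U_def)
  qed
  moreover have "topspace X \<subseteq> \<Union> (U ` topspace X)"
    using G by (auto simp: U_def)
  ultimately obtain \<F> where "finite \<F>" "\<F> \<subseteq> U ` topspace X" "topspace X \<subseteq> \<Union> \<F>"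
    using compactinD[of X "topspace X" "U ` topspace X"] compact by (auto simp: compact_space_def)
  then obtain F where F: "finite F" "F \<subseteq> topspace X" "topspace X \<subseteq> (\<Union>x\<in>F. U x)"
    by (metis finite_subset_image)
  have GF: "dev (G i) \<in> B" if "i \<in> F" for i
    using G that F(2) by (intro dev_bounded_funs) blast
  have "L (\<lambda>x. \<Sum>i\<in>I. dev (G i) x) = 0" if "finite I" "I \<subseteq> F" for I
    using that
  proof (induction I rule: finite_induct)
    case empty
    then show ?case
      by (simp add: L_const)
  next
    case (insert i I)
    have "(\<lambda>x. \<Sum>i\<in>I. dev (G i) x) \<in> B"
      using insert GF by (intro bounded_funs_sum) auto
    then show ?case
      using insert L_add[OF GF] L_dev G F(2) by (simp add: subset_iff)
  qed
  moreover have "L h \<le> L (\<lambda>x. \<Sum>i\<in>F. dev (G i) x)"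
  proof (rule L_mono)
    fix z assume "z \<in> topspace X"
    then obtain i where i: "i \<in> F" "h z < dev (G i) z"
      using F(3) by (auto simp: U_def)
    have "dev (G i) z \<le> (\<Sum>i\<in>F. dev (G i) z)"
      using F(1) i(1) by (intro member_le_sum) (auto simp: dev_def)
    with i(2) show "h z \<le> (\<Sum>i\<in>F. dev (G i) z)"
      by simp
  qed (use F(1) GF in \<open>auto intro: bounded_funs_sum continuous_map_bounded_funs[OF compact h]\<close>)
  ultimately show ?thesis
    using F(1) by simp
qed

text \<open>Otherwise every point has an element of \<open>S\<close> with nonzero deviation there,
  which can be scaled above 1; then \<open>L 1 = 1\<close> would be nonpositive.\<close>

lemma ex_point: "\<exists>x\<in>topspace X. \<forall>g\<in>S. re (\<phi> g) = re (g x)"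
proof (rule ccontr)
  assume contra: "\<not> ?thesis"
  have "L (\<lambda>x. 1) \<le> 0"
  proof (rule L_nonpos)
    fix x assume "x \<in> topspace X"
    then obtain g where "g \<in> S" "dev g x \<noteq> 0"
      using contra by (auto simp: dev_def)
    then show "\<exists>g\<in>S. 1 < dev g x"
      by (rule dev_large)
  qed simp
  then show False
    by (simp add: L_const)
qed

text \<open>Apply \<open>L_nonpos\<close> to \<open>f - (f x0 + e)\<close>. At \<open>x0\<close>
  this function is negative and the zero element of \<open>S\<close> suffices; elsewhere a
  separating \<open>g\<close>, or \<open>J * g\<close> when only imaginary parts differ, has nonzero
  deviation and can be scaled.\<close>

lemma L_le_point:
  assumes x0: "x0 \<in> topspace X" "\<And>g. g \<in> S \<Longrightarrow> re (\<phi> g) = re (g x0)"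
    and f: "continuous_map X euclideanreal f"
  shows "L f \<le> f x0"
proof (rule field_le_epsilon)
  fix e :: real assume e: "0 < e"
  have "L (\<lambda>x. f x - (f x0 + e)) \<le> 0"
  proof (rule L_nonpos)
    fix x assume x: "x \<in> topspace X"
    show "\<exists>g\<in>S. f x - (f x0 + e) < dev g x"
    proof (cases "x = x0")
      case True
      then show ?thesis
        using e S_zero by (intro bexI[of _ "\<lambda>x. 0"]) (simp_all add: dev_def \<phi>_zero)
    next
      case False
      then obtain g where g: "g \<in> S" "g x \<noteq> g x0"
        using S x x0(1) unfolding function_space_def by metis
      then have "re (g x) \<noteq> re (g x0) \<or> re (J * g x) \<noteq> re (J * g x0)"
        using eqI by blast
      then have "\<exists>g\<in>S. dev g x \<noteq> 0"
      proof
        assume "re (g x) \<noteq> re (g x0)"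
        then show ?thesis
          using x0(2)[OF g(1)] by (intro bexI[OF _ g(1)]) (simp add: dev_def)
      next
        assume "re (J * g x) \<noteq> re (J * g x0)"
        then show ?thesis
          using x0(2)[OF S_scale[OF g(1), of J]]
          by (intro bexI[OF _ S_scale[OF g(1), of J]]) (simp add: dev_def)
      qed
      then show ?thesis
        using dev_large by blast
    qed
  qed (intro continuous_intros f continuous_map_const[THEN iffD2]; simp)
  moreover have "L (\<lambda>x. f x - (f x0 + e)) = L f - (f x0 + e)"
    using L_diff[OF continuous_map_bounded_funs[OF compact f] bounded_funs_const] by (simp add: L_const)
  ultimately show "L f \<le> f x0 + e"
    by simp
qed

end

context extreme_state
begin

lemma ex_positive_extension:
  assumes f: "f \<in> bounded_funs (topspace X)"
  shows "\<exists>L. positive_extension re J X S \<phi> L \<and> L f = upper f"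
proof -
  obtain L where "linear_functional_on (bounded_funs (topspace X)) L"
    "\<And>v. v \<in> bounded_funs (topspace X) \<Longrightarrow> L v \<le> upper v" "L f = upper f"
    by (rule hahn_banach_sublinear[OF bounded_funs_lin_subspace upper_sublinear f]) (rule that)
  then show ?thesis
    by (intro exI[of _ L] conjI positive_extension.intro positive_extension_axioms.intro
        extreme_state_axioms) auto
qed

text \<open>One extension yields \<open>x0\<close>, but its defining property
  \<open>re (\<phi> g) = re (g x0)\<close> involves only \<open>\<phi>\<close>. Hence the same
  \<open>x0\<close> serves the extension that attains \<open>upper f\<close> at \<open>f\<close>, so
  \<open>upper f \<le> f x0\<close>, and a near-optimal competitor in the infimum is the required
  \<open>g\<close>.\<close>

theorem ex_representing_point:
  obtains x0 where "x0 \<in> topspace X"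
    "\<And>f e. \<lbrakk>continuous_map X euclideanreal f; 0 < e\<rbrakk> \<Longrightarrow>
      \<exists>g\<in>S. (\<forall>x\<in>topspace X. f x \<le> re (g x)) \<and> re (\<phi> g) < f x0 + e"
proof -
  obtain L where "positive_extension re J X S \<phi> L"
    using ex_positive_extension[OF bounded_funs_const] by blast
  then obtain x0 where x0: "x0 \<in> topspace X" "\<forall>g\<in>S. re (\<phi> g) = re (g x0)"
    using positive_extension.ex_point by blast
  show thesis
  proof (rule that[OF x0(1)])
    fix f and e :: real assume f: "continuous_map X euclideanreal f" and e: "0 < e"
    have fB: "f \<in> bounded_funs (topspace X)"
      by (rule continuous_map_bounded_funs[OF compact f])
    obtain L where L: "positive_extension re J X S \<phi> L" "L f = upper f"
      using ex_positive_extension[OF fB] by blast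
    have "upper f \<le> f x0"
      using positive_extension.L_le_point[OF L(1) x0(1) _ f] x0(2) L(2) by simp
    then have less: "upper f < f x0 + e"
      using e by simp
    show "\<exists>g\<in>S. (\<forall>x\<in>topspace X. f x \<le> re (g x)) \<and> re (\<phi> g) < f x0 + e"
    proof (rule ccontr)
      assume "\<not> ?thesis"
      then have "f x0 + e \<le> upper f"
        by (intro upper_greatest[OF fB]) (auto simp: not_less)
      then show False
        using less by simp
    qed
  qed
qed

end

section \<open>Positive maps and the linear behaviour of the limit on \<open>S\<close>\<close>

section \<open>Positive maps and the limit isometry\<close>

context real_part
begin

text \<open>Write \<open>k\<close> as its real part minus \<open>J\<close> times the real function
  \<open>re (J * k)\<close>. A real function in \<open>M\<close> has real image, being a nonnegative
  function minus a constant, so the second term contributes nothing to the real part of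
  \<open>T k y\<close>.\<close>

lemma positive_map_re_nonneg:
  assumes X: "compact_space X" and M: "lin_subspace M" "M \<subseteq> Cfun X" "self_conjugate M"
    and one: "(\<lambda>x. if x \<in> topspace X then 1 else 0) \<in> M"
    and T: "linear_map_on M T" "positive_map_on X Y M T"
    and k: "k \<in> M" "\<And>x. x \<in> topspace X \<Longrightarrow> 0 \<le> re (k x)" and y: "y \<in> topspace Y"
  shows "0 \<le> re (T k y)"
proof -
  note M_add = lin_subspace_add[OF M(1)] and M_scale = lin_subspace_scale[OF M(1)]
  let ?one = "\<lambda>x. if x \<in> topspace X then (1::'k) else 0"
  have T_add: "T (\<lambda>x. f x + g x) y = T f y + T g y" if "f \<in> M" "g \<in> M" for f g
    using T(1) that unfolding linear_map_on_def by metis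
  have T_scale: "T (\<lambda>x. c * f x) y = c * T f y" if "f \<in> M" for f c
    using T(1) that unfolding linear_map_on_def by metis
  have T_pos: "\<exists>r\<ge>0. T f y = of_real r"
    if "f \<in> M" "\<And>x. x \<in> topspace X \<Longrightarrow> \<exists>r\<ge>0. f x = of_real r" for f
    using T(2) that y unfolding positive_map_on_def nonneg_on_def by metis
  have re_part: "(\<lambda>x. of_real (re (f x))) \<in> M" if f: "f \<in> M" for f
  proof -
    have "(\<lambda>x. sconj (f x)) \<in> M"
      using M(3) f unfolding self_conjugate_def by metis
    from M_scale[OF M_add[OF f this], of "1/2"] show ?thesis
      by (simp add: sconj_eq)
  qed
  have T_real: "\<exists>r. T (\<lambda>x. of_real (re (f x))) y = of_real r" if f: "f \<in> M" for f
  proof -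
    obtain N where N: "\<And>x. x \<in> topspace X \<Longrightarrow> norm (f x) \<le> N"
      using Cfun_bounded[OF X] M(2) f by (metis bounded_iff image_eqI subsetD)
    let ?N = "\<bar>N\<bar>"
    have N1: "(\<lambda>x. of_real ?N * ?one x) \<in> M"
      by (rule M_scale[OF one])
    obtain r where r: "T (\<lambda>x. of_real (re (f x)) + of_real ?N * ?one x) y = of_real r"
    proof -
      have "\<exists>r\<ge>0. of_real (re (f x)) + of_real ?N * ?one x = (of_real r :: 'k)"
        if x: "x \<in> topspace X" for x
      proof (intro exI conjI)
        show "0 \<le> re (f x) + ?N"
          using abs_re_le[of "f x"] N[OF x] by simp
      qed (use x in simp)
      from T_pos[OF M_add[OF re_part[OF f] N1] this] that show ?thesis
        by metis
    qed
    obtain s where s: "T ?one y = of_real s"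
      using T_pos[OF one] by (metis of_real_1 zero_le_one)
    have "T (\<lambda>x. of_real (re (f x))) y = of_real (r - ?N * s)"
      using r by (simp only: T_add[OF re_part[OF f] N1] T_scale[OF one] s) (simp add: algebra_simps)
    then show ?thesis ..
  qed
  obtain r where r: "0 \<le> r" "T (\<lambda>x. of_real (re (k x))) y = of_real r"
    using T_pos[OF re_part[OF k(1)]] k(2) by metis
  obtain s where s: "T (\<lambda>x. of_real (re (J * k x))) y = of_real s"
    using T_real[OF M_scale[OF k(1)]] by metis
  have "T k y = T (\<lambda>x. of_real (re (k x)) + (- J) * of_real (re (J * k x))) y"
    using decomp[symmetric] by simp
  also have "\<dots> = of_real r - J * of_real s"
    by (simp only: T_add[OF re_part[OF k(1)] M_scale[OF re_part[OF M_scale[OF k(1)]]]]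
        T_scale[OF re_part[OF M_scale[OF k(1)]]] r s) simp
  finally show ?thesis
    using r(1) by (simp add: re_diff re_mult_of_real)
qed

end

locale korovkin = real_part re J
  for re :: "'k::real_normed_field \<Rightarrow> real" and J :: 'k +
  fixes X :: "'a topology" and Y :: "'b topology"
    and M S :: "('a \<Rightarrow> 'k) set"
    and T :: "nat \<Rightarrow> ('a \<Rightarrow> 'k) \<Rightarrow> ('b \<Rightarrow> 'k)"
    and Tinf :: "('a \<Rightarrow> 'k) \<Rightarrow> ('b \<Rightarrow> 'k)"
  assumes X: "compact_space X" and Y: "compact_space Y"
    and M: "lin_subspace M" "M \<subseteq> Cfun X" "self_conjugate M"
    and S: "function_space X S" "S \<subseteq> M"
    and Tn: "\<And>n. linear_map_on M (T n)" "\<And>n. T n ` M \<subseteq> Cfun Y" "\<And>n. positive_map_on X Y M (T n)"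
    and Tinf_into: "Tinf ` M \<subseteq> Cfun Y"
    and Tinf_isom: "\<And>f g. f \<in> M \<Longrightarrow> g \<in> M \<Longrightarrow>
          supnorm Y (\<lambda>y. Tinf f y - Tinf g y) = supnorm X (\<lambda>x. f x - g x)"
    and conv: "\<And>f. f \<in> S \<Longrightarrow> (\<lambda>n. supnorm Y (\<lambda>y. T n f y - Tinf f y)) \<longlonglongrightarrow> 0"
begin

abbreviation one :: "'a \<Rightarrow> 'k" where
  "one \<equiv> \<lambda>x. if x \<in> topspace X then 1 else 0"

lemma S_lin: "lin_subspace S" and one_S: "one \<in> S"
  using S(1) by (simp_all add: function_space_def)

lemmas S_zero = lin_subspace_zero[OF S_lin] and S_add = lin_subspace_add[OF S_lin]
  and S_scale = lin_subspace_scale[OF S_lin]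
lemmas M_add = lin_subspace_add[OF M(1)] and M_scale = lin_subspace_scale[OF M(1)]

lemma S_M: "f \<in> S \<Longrightarrow> f \<in> M"
  using S(2) by blast

lemma T_add: "\<lbrakk>f \<in> M; g \<in> M\<rbrakk> \<Longrightarrow> T n (\<lambda>x. f x + g x) y = T n f y + T n g y"
  using Tn(1)[of n] unfolding linear_map_on_def by metis

lemma T_scale: "f \<in> M \<Longrightarrow> T n (\<lambda>x. c * f x) y = c * T n f y"
  using Tn(1)[of n] unfolding linear_map_on_def by metis

lemma T_Cfun: "f \<in> M \<Longrightarrow> T n f \<in> Cfun Y" and Tinf_Cfun: "f \<in> M \<Longrightarrow> Tinf f \<in> Cfun Y"
  using Tn(2) Tinf_into by blast+

lemma T_re_nonneg:
  "\<lbrakk>k \<in> M; \<And>x. x \<in> topspace X \<Longrightarrow> 0 \<le> re (k x); y \<in> topspace Y\<rbrakk> \<Longrightarrow> 0 \<le> re (T n k y)"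
  by (rule positive_map_re_nonneg[OF X M S_M[OF one_S] Tn(1,3)])

lemma T_re_mono:
  assumes "f \<in> M" "g \<in> M" "\<And>x. x \<in> topspace X \<Longrightarrow> re (f x) \<le> re (g x)" "y \<in> topspace Y"
  shows "re (T n f y) \<le> re (T n g y)"
proof -
  have "0 \<le> re (T n (\<lambda>x. g x + - 1 * f x) y)"
    using assms by (intro T_re_nonneg M_add M_scale) (auto simp: re_diff)
  also have "T n (\<lambda>x. g x + - 1 * f x) y = T n g y - T n f y"
    by (simp only: T_add[OF assms(2) M_scale[OF assms(1)]] T_scale[OF assms(1)]) simp
  finally show ?thesis
    by (simp add: re_diff)
qed

text \<open>After rotation by a unimodular \<open>c\<close> the value is real, and monotonicity
  compares \<open>c * g\<close> with the constant \<open>supnorm X g\<close>.\<close>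

lemma norm_T_le:
  assumes g: "g \<in> M" and y: "y \<in> topspace Y"
  shows "norm (T n g y) \<le> supnorm X g * re (T n one y)"
proof -
  obtain c where c: "norm c = 1" "c * T n g y = of_real (norm (T n g y))"
    by (rule ex_unit_mult_eq_norm)
  have "norm (T n g y) = re (T n (\<lambda>x. c * g x) y)"
    using c(2) by (simp add: T_scale[OF g])
  also have "\<dots> \<le> re (T n (\<lambda>x. of_real (supnorm X g) * one x) y)"
  proof (rule T_re_mono[OF M_scale[OF g] M_scale[OF S_M[OF one_S]] _ y])
    fix x assume x: "x \<in> topspace X"
    have "norm (g x) \<le> supnorm X g"
      using M(2) g by (intro norm_le_supnorm Cfun_bounded X x) auto
    then show "re (c * g x) \<le> re (of_real (supnorm X g) * one x)"
      using x abs_re_le[of "c * g x"] c(1) by (simp add: norm_mult)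
  qed
  also have "\<dots> = supnorm X g * re (T n one y)"
    by (simp only: T_scale[OF S_M[OF one_S]] re_of_real_mult)
  finally show ?thesis .
qed

lemma T_diff_bounded: "f \<in> M \<Longrightarrow> bounded ((\<lambda>y. T n f y - Tinf f y) ` topspace Y)"
  by (intro Cfun_bounded[OF Y] Cfun_diff T_Cfun Tinf_Cfun)

lemma T_tendsto:
  assumes g: "g \<in> S" and y: "y \<in> topspace Y"
  shows "(\<lambda>n. T n g y) \<longlonglongrightarrow> Tinf g y"
proof -
  have "(\<lambda>n. T n g y - Tinf g y) \<longlonglongrightarrow> 0"
    by (rule Lim_null_comparison[OF _ conv[OF g]])
      (simp add: norm_le_supnorm[OF T_diff_bounded[OF S_M[OF g]] y])
  then show ?thesis
    by (simp add: LIM_zero_iff)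
qed

lemma Tinf_outside: "\<lbrakk>f \<in> M; y \<notin> topspace Y\<rbrakk> \<Longrightarrow> Tinf f y = 0"
  using Tinf_Cfun[of f] by (simp add: Cfun_def)

text \<open>On \<open>S\<close> linearity is inherited from the maps \<open>T n\<close> by pointwise
  limits; outside the space \<open>Y\<close> both sides are 0.\<close>

lemma Tinf_add:
  assumes f: "f \<in> S" and g: "g \<in> S"
  shows "Tinf (\<lambda>x. f x + g x) = (\<lambda>y. Tinf f y + Tinf g y)"
proof
  fix y
  show "Tinf (\<lambda>x. f x + g x) y = Tinf f y + Tinf g y"
  proof (cases "y \<in> topspace Y")
    case True
    have "(\<lambda>n. T n (\<lambda>x. f x + g x) y) \<longlonglongrightarrow> Tinf f y + Tinf g y"
      unfolding T_add[OF S_M[OF f] S_M[OF g]] by (intro tendsto_add T_tendsto f g True)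
    then show ?thesis
      using T_tendsto[OF S_add[OF f g] True] LIMSEQ_unique by blast
  qed (simp add: Tinf_outside S_M S_add f g)
qed

lemma Tinf_scale:
  assumes f: "f \<in> S"
  shows "Tinf (\<lambda>x. c * f x) = (\<lambda>y. c * Tinf f y)"
proof
  fix y
  show "Tinf (\<lambda>x. c * f x) y = c * Tinf f y"
  proof (cases "y \<in> topspace Y")
    case True
    have "(\<lambda>n. T n (\<lambda>x. c * f x) y) \<longlonglongrightarrow> c * Tinf f y"
      unfolding T_scale[OF S_M[OF f]] by (intro tendsto_mult tendsto_const T_tendsto f True)
    then show ?thesis
      using T_tendsto[OF S_scale[OF f] True] LIMSEQ_unique by blast
  qed (simp add: Tinf_outside S_M S_scale f)
qed

lemma supnorm_Tinf:
  assumes f: "f \<in> S"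
  shows "supnorm Y (Tinf f) = supnorm X f"
proof -
  have "Tinf (\<lambda>x. 0) = (\<lambda>y. 0)"
    using Tinf_scale[OF S_zero, of 0] by simp
  then show ?thesis
    using Tinf_isom[OF S_M[OF f] S_M[OF S_zero]] by simp
qed

lemma inj_Tinf: "inj_on Tinf S"
proof (rule inj_onI)
  fix f g assume fg: "f \<in> S" "g \<in> S" "Tinf f = Tinf g"
  have "f x - g x = 0" for x
  proof (cases "x \<in> topspace X")
    case True
    have "norm (f x - g x) \<le> supnorm X (\<lambda>x. f x - g x)"
      using M(2) fg(1,2) S_M
      by (intro norm_le_supnorm[where f = "\<lambda>x. f x - g x"] Cfun_bounded X Cfun_diff True) auto
    also have "\<dots> = supnorm Y (\<lambda>y. 0 :: 'k)"
      using Tinf_isom[OF S_M[OF fg(1)] S_M[OF fg(2)]] fg(3) by simp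
    also have "\<dots> \<le> 0"
      by (rule supnorm_least) auto
    finally show ?thesis
      by simp
  next
    case False
    then show ?thesis
      using subsetD[OF M(2) S_M[OF fg(1)]] subsetD[OF M(2) S_M[OF fg(2)]] by (simp add: Cfun_def)
  qed
  then show "f = g"
    by (simp add: fun_eq_iff)
qed

section \<open>Choquet boundary points as extreme states on \<open>S\<close>\<close>

text \<open>\<open>Tinf\<close> restricts to a linear isometry of \<open>S\<close> onto its image,
  so composing with the inverse carries one dual ball into the other. This transfers extremality
  from \<open>Y\<close> to functionals on \<open>S\<close>.\<close>

lemma dual_ball_pullback:
  assumes \<phi>: "\<phi> \<in> dual_ball X S"
  shows "(\<lambda>a. \<phi> (inv_into S Tinf a)) \<in> dual_ball Y (Tinf ` S)"
proof -
  note lin = dual_ball_linear[OF \<phi>]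
  have inv: "inv_into S Tinf (Tinf f) = f" if "f \<in> S" for f
    using inv_into_f_f[OF inj_Tinf that] .
  show ?thesis
    unfolding dual_ball_def linear_functional_on_def mem_Collect_eq
  proof (intro conjI ballI allI impI)
    fix a b assume "a \<in> Tinf ` S" "b \<in> Tinf ` S"
    then obtain f g where fg: "f \<in> S" "a = Tinf f" "g \<in> S" "b = Tinf g"
      by blast
    have "inv_into S Tinf (\<lambda>y. a y + b y) = (\<lambda>x. f x + g x)"
      using inv[OF S_add[OF fg(1,3)]] by (simp only: Tinf_add[OF fg(1,3)] fg(2,4))
    then show "\<phi> (inv_into S Tinf (\<lambda>y. a y + b y)) = \<phi> (inv_into S Tinf a) + \<phi> (inv_into S Tinf b)"
      using linear_functional_on_add[OF lin fg(1,3) S_add[OF fg(1,3)]]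
      by (simp only: fg(2,4) inv[OF fg(1)] inv[OF fg(3)])
  next
    fix a c assume "a \<in> Tinf ` S"
    then obtain f where f: "f \<in> S" "a = Tinf f"
      by blast
    have "inv_into S Tinf (\<lambda>y. c * a y) = (\<lambda>x. c * f x)"
      using inv[OF S_scale[OF f(1)]] by (simp only: Tinf_scale[OF f(1)] f(2))
    then show "\<phi> (inv_into S Tinf (\<lambda>y. c * a y)) = c * \<phi> (inv_into S Tinf a)"
      using linear_functional_on_scale[OF lin f(1) S_scale[OF f(1)]]
      by (simp only: f(2) inv[OF f(1)])
  next
    fix a assume "a \<in> Tinf ` S"
    then obtain f where f: "f \<in> S" "a = Tinf f"
      by blast
    show "norm (\<phi> (inv_into S Tinf a)) \<le> supnorm Y a"
      using dual_ball_norm[OF \<phi> f(1)] by (simp only: f(2) inv[OF f(1)] supnorm_Tinf[OF f(1)])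
  qed
qed

lemma choquet_extreme:
  assumes y: "y \<in> choquet_boundary Y (Tinf ` S)"
    and \<phi>: "\<phi>1 \<in> dual_ball X S" "\<phi>2 \<in> dual_ball X S" and t: "0 < t" "t < 1"
    and eq: "\<And>g. g \<in> S \<Longrightarrow> Tinf g y = of_real t * \<phi>1 g + of_real (1 - t) * \<phi>2 g"
    and g: "g \<in> S"
  shows "\<phi>1 g = \<phi>2 g"
proof -
  have inv: "inv_into S Tinf (Tinf f) = f" if "f \<in> S" for f
    using inv_into_f_f[OF inj_Tinf that] .
  have split: "\<forall>a\<in>Tinf ` S. a y = of_real t * \<phi>1 (inv_into S Tinf a) + of_real (1 - t) * \<phi>2 (inv_into S Tinf a)"
    using eq inv by auto
  have extreme: "\<forall>\<psi>1\<in>dual_ball Y (Tinf ` S). \<forall>\<psi>2\<in>dual_ball Y (Tinf ` S). \<forall>t::real. 0 < t \<and> t < 1 \<and>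
      (\<forall>a\<in>Tinf ` S. a y = of_real t * \<psi>1 a + of_real (1 - t) * \<psi>2 a) \<longrightarrow>
      (\<forall>a\<in>Tinf ` S. \<psi>1 a = \<psi>2 a)"
    using y unfolding choquet_boundary_def by blast
  have "\<forall>a\<in>Tinf ` S. \<phi>1 (inv_into S Tinf a) = \<phi>2 (inv_into S Tinf a)"
    using extreme[THEN bspec, OF dual_ball_pullback[OF \<phi>(1)], THEN bspec,
        OF dual_ball_pullback[OF \<phi>(2)], THEN spec[of _ t]] split t by simp
  then show ?thesis
    using inv[OF g] g by force
qed

lemma norm_Tinf_le:
  assumes g: "g \<in> S" and y: "y \<in> topspace Y"
  shows "norm (Tinf g y) \<le> supnorm X g * re (Tinf one y)"
proof (rule LIMSEQ_le)
  show "(\<lambda>n. norm (T n g y)) \<longlonglongrightarrow> norm (Tinf g y)"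
    by (intro tendsto_norm T_tendsto g y)
  show "(\<lambda>n. supnorm X g * re (T n one y)) \<longlonglongrightarrow> supnorm X g * re (Tinf one y)"
    by (intro tendsto_mult tendsto_const tendsto_re T_tendsto one_S y)
qed (use norm_T_le[OF S_M[OF g] y] in blast)

lemma Tinf_one_real:
  assumes y: "y \<in> topspace Y"
  shows "Tinf one y = of_real (re (Tinf one y))"
proof -
  have real: "of_real (re (T n one y)) = T n one y" for n
  proof -
    have "nonneg_on (topspace X) one"
      unfolding nonneg_on_def by (auto intro!: exI[of _ 1])
    then have "nonneg_on (topspace Y) (T n one)"
      using Tn(3)[of n] S_M[OF one_S] unfolding positive_map_on_def by blast
    then obtain r where "T n one y = of_real r"
      using y unfolding nonneg_on_def by blast
    then show ?thesis
      by simp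
  qed
  have "(\<lambda>n. T n one y) \<longlonglongrightarrow> of_real (re (Tinf one y))"
    using tendsto_of_real[OF tendsto_re[OF T_tendsto[OF one_S y]], where 'a='k] unfolding real .
  then show ?thesis
    using T_tendsto[OF one_S y] LIMSEQ_unique by blast
qed

text \<open>The divisor \<open>r\<close> covers two uses: \<open>r = re (Tinf one y)\<close>
  renormalises the functional, and \<open>r = 1\<close> leaves it unchanged.\<close>

lemma Tinf_dual_ball: "\<lbrakk>y \<in> topspace Y; 0 < r; re (Tinf one y) \<le> r\<rbrakk> \<Longrightarrow> (\<lambda>g. Tinf g y / of_real r) \<in> dual_ball X S"
proof -
  assume y: "y \<in> topspace Y" and r: "0 < r" "re (Tinf one y) \<le> r"
  have "norm (Tinf g y / of_real r) \<le> supnorm X g" if g: "g \<in> S" for g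
  proof -
    have "0 \<le> supnorm X g"
      using M(2) S_M[OF g] by (intro supnorm_nonneg Cfun_bounded X) auto
    then have "norm (Tinf g y) \<le> supnorm X g * r"
      using norm_Tinf_le[OF g y] mult_left_mono[OF r(2), of "supnorm X g"] by simp
    then show ?thesis
      using r(1) by (simp add: norm_divide field_simps)
  qed
  then show ?thesis
    by (simp add: dual_ball_def linear_functional_on_def Tinf_add Tinf_scale add_divide_distrib)
qed

lemma choquet_topspace: "y \<in> choquet_boundary Y A \<Longrightarrow> y \<in> topspace Y"
  by (simp add: choquet_boundary_def)

text \<open>If \<open>Tinf one y = r\<close> were less than \<open>1\<close>, then \<open>\<phi>\<close> would be a convex combination of \<open>\<phi> / r\<close> and \<open>0\<close>, or,
  when \<open>r = 0\<close>, of the evaluation at \<open>x\<close> and its negative.\<close>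

lemma Tinf_one:
  assumes y: "y \<in> choquet_boundary Y (Tinf ` S)" and x: "x \<in> topspace X"
  shows "Tinf one y = 1"
proof -
  note yY = choquet_topspace[OF y]
  define r where "r = re (Tinf one y)"
  have one: "Tinf one y = of_real r"
    using Tinf_one_real[OF yY] by (simp add: r_def)
  have supnorm_one: "supnorm X one \<le> 1"
    by (rule supnorm_least) auto
  have one_norm: "norm (Tinf one y) \<le> supnorm Y (Tinf one)"
    by (intro norm_le_supnorm Cfun_bounded Y Tinf_Cfun S_M one_S yY)
  have "0 \<le> r"
    unfolding r_def
    by (rule LIMSEQ_le_const[OF tendsto_re[OF T_tendsto[OF one_S yY]]])
      (auto intro!: T_re_nonneg S_M one_S yY simp: re_1)
  have "r \<le> 1"
    using one_norm supnorm_one by (simp add: one supnorm_Tinf[OF one_S])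
  have "r = 1"
  proof (rule ccontr)
    assume "r \<noteq> 1"
    then have "r < 1"
      using \<open>r \<le> 1\<close> by simp
    show False
    proof (cases "r = 0")
      case True
      have "norm (g x) \<le> supnorm X g" if "g \<in> S" for g
        using M(2) S_M[OF that] by (intro norm_le_supnorm Cfun_bounded X x) auto
      then have "(\<lambda>g. g x) \<in> dual_ball X S" "(\<lambda>g. - g x) \<in> dual_ball X S"
        by (simp_all add: dual_ball_def linear_functional_on_def)
      moreover have "Tinf g y = 0" if "g \<in> S" for g
        using norm_Tinf_le[OF that yY] True by (simp add: r_def)
      ultimately have "one x = - one x"
        by (intro choquet_extreme[OF y, of "\<lambda>g. g x" "\<lambda>g. - g x" "1/2"] one_S) auto
      then have "re (1::'k) = re (- 1)"
        using x by simp
      then show False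
        by (simp only: re_minus re_1)
    next
      case False
      then have "0 < r"
        using \<open>0 \<le> r\<close> by simp
      have "0 \<le> supnorm X g" if "g \<in> S" for g
        using M(2) S_M[OF that] by (intro supnorm_nonneg Cfun_bounded X) auto
      then have "(\<lambda>g. 0) \<in> dual_ball X S"
        by (simp add: dual_ball_def linear_functional_on_def)
      then have "Tinf one y / of_real r = 0"
        using \<open>0 < r\<close> \<open>r < 1\<close>
        by (intro choquet_extreme[OF y Tinf_dual_ball[OF yY \<open>0 < r\<close>], of "\<lambda>g. 0" r] one_S) (auto simp: r_def)
      then show False
        using \<open>0 < r\<close> by (simp add: one)
    qed
  qed
  then show ?thesis
    by (simp add: one)
qed

lemma choquet_extreme_state:
  assumes y: "y \<in> choquet_boundary Y (Tinf ` S)" and x: "x \<in> topspace X"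
  shows "extreme_state re J X S (\<lambda>g. Tinf g y)"
proof (intro extreme_state.intro extreme_state_axioms.intro real_part_axioms X S(1) Tinf_one[OF y x])
  show "(\<lambda>g. Tinf g y) \<in> dual_ball X S"
    using Tinf_dual_ball[OF choquet_topspace[OF y], of 1] Tinf_one[OF y x] by (simp add: re_1)
qed (rule choquet_extreme[OF y]; assumption)

text \<open>Majorants of \<open>c * f\<close> from \<open>S\<close>, fed into
  \<open>re_le_of_dominated\<close>, give \<open>re (c * Tinf f y) \<le> re (c * f x0)\<close> for
  every unimodular \<open>c\<close>. Taking \<open>c\<close> to be 1, -1 and, if nonzero,
  \<open>J\<close> and \<open>- J\<close> yields equality.\<close>

lemma choquet_point:
  assumes y: "y \<in> choquet_boundary Y (Tinf ` S)" and x: "x \<in> topspace X"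
  obtains x0 where "\<And>f. f \<in> M \<Longrightarrow> Tinf f y = f x0"
    "\<And>f e. \<lbrakk>f \<in> M; 0 < e\<rbrakk> \<Longrightarrow>
      \<exists>g\<in>S. (\<forall>x\<in>topspace X. re (f x) \<le> re (g x)) \<and> re (Tinf g y) < re (f x0) + e"
proof -
  interpret E: extreme_state re J X S "\<lambda>g. Tinf g y"
    by (rule choquet_extreme_state[OF y x])
  obtain x0 where x0: "x0 \<in> topspace X"
    "\<And>f e. \<lbrakk>continuous_map X euclideanreal f; 0 < e\<rbrakk> \<Longrightarrow>
      \<exists>g\<in>S. (\<forall>x\<in>topspace X. f x \<le> re (g x)) \<and> re (Tinf g y) < f x0 + e"
    by (rule E.ex_representing_point) (rule that)
  have approx: "\<exists>g\<in>S. (\<forall>x\<in>topspace X. re (f x) \<le> re (g x)) \<and> re (Tinf g y) < re (f x0) + e"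
    if "f \<in> M" "0 < e" for f e
    using M(2) that by (intro x0(2) continuous_map_re) (auto simp: Cfun_def)
  have le: "re (c * Tinf f y) \<le> re (c * f x0)" if f: "f \<in> M" and c: "norm c = 1" for f c
  proof (rule field_le_epsilon)
    fix e :: real assume "0 < e"
    then obtain g where g: "g \<in> S" "\<forall>x\<in>topspace X. re (c * f x) \<le> re (g x)"
        "re (Tinf g y) < re (c * f x0) + e"
      using approx[OF M_scale[OF f]] by blast
    have "re (c * Tinf f y) \<le> re (Tinf g y)"
    proof (rule E.re_le_of_dominated[OF _ _ g(1)])
      show "(\<lambda>x. c * f x) \<in> Cfun X"
        using M(2) M_scale[OF f] by blast
      fix h assume h: "h \<in> S"
      \<comment> \<open>At this stage homogeneity of \<open>Tinf\<close> is available on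
        \<open>S\<close> only, so the factor \<open>c\<close> is moved from \<open>f\<close> onto
        \<open>h\<close> before the isometry property is applied.\<close>
      define k where "k = (\<lambda>x. inverse c * h x)"
      have k: "k \<in> S"
        unfolding k_def by (rule S_scale[OF h])
      have "c \<noteq> 0"
        using c by auto
      then have hk: "h = (\<lambda>x. c * k x)"
        by (simp add: k_def flip: mult.assoc)
      have "norm (c * Tinf f y - Tinf h y) = norm (Tinf f y - Tinf k y)"
        unfolding hk Tinf_scale[OF k] using c by (simp add: norm_mult flip: right_diff_distrib)
      also have "\<dots> \<le> supnorm Y (\<lambda>y. Tinf f y - Tinf k y)"
        by (intro norm_le_supnorm[where f = "\<lambda>y. Tinf f y - Tinf k y"] Cfun_bounded Y Cfun_diff
            Tinf_Cfun f S_M k choquet_topspace[OF y])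
      also have "\<dots> = supnorm X (\<lambda>x. f x - k x)"
        by (rule Tinf_isom[OF f S_M[OF k]])
      also have "\<dots> = supnorm X (\<lambda>x. c * f x - h x)"
        unfolding hk supnorm_def using c by (simp add: norm_mult flip: right_diff_distrib)
      finally show "norm (c * Tinf f y - Tinf h y) \<le> supnorm X (\<lambda>x. c * f x - h x)" .
    qed (use g(2) in blast)
    then show "re (c * Tinf f y) \<le> re (c * f x0) + e"
      using g(3) by simp
  qed
  have "Tinf f y = f x0" if f: "f \<in> M" for f
  proof (rule eqI)
    show "re (Tinf f y) = re (f x0)"
      using le[OF f, of 1] le[OF f, of "- 1"] by (simp add: re_minus)
    show "re (J * Tinf f y) = re (J * f x0)"
    proof (cases "J = 0")
      case False
      then have "norm J * norm J = 1"
        using J_cases by (metis norm_minus_cancel norm_mult norm_one)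
      then have "norm J = 1"
        using power2_eq_iff_nonneg[of "norm J" 1] by (simp add: power2_eq_square)
      then show ?thesis
        using le[OF f, of J] le[OF f, of "- J"] by (simp add: re_minus)
    qed simp
  qed
  then show thesis
    using approx by (rule that)
qed

section \<open>Uniform convergence on compact subsets of the Choquet boundary\<close>

text \<open>Half of \<open>e\<close> pays for replacing \<open>f\<close> by its majorant
  \<open>G z\<close> on the neighbourhood \<open>U z\<close>, the other half for the uniform
  convergence of \<open>T n (G z)\<close>, needed at the finitely many centres \<open>z\<close> in
  \<open>F\<close> only.\<close>

lemma eventually_re_less:
  assumes K: "compactin Y K" "K \<subseteq> choquet_boundary Y (Tinf ` S)" and x: "x \<in> topspace X"
    and f: "f \<in> M" and e: "0 < e"
  shows "\<forall>\<^sub>F n in sequentially. \<forall>y\<in>K. re (T n f y) < re (Tinf f y) + e"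
proof -
  have "\<exists>g\<in>S. (\<forall>x\<in>topspace X. re (f x) \<le> re (g x)) \<and> re (Tinf g y) < re (Tinf f y) + e / 2"
    if "y \<in> K" for y
  proof -
    have "y \<in> choquet_boundary Y (Tinf ` S)"
      using K(2) that by blast
    then obtain x0 where "\<And>f. f \<in> M \<Longrightarrow> Tinf f y = f x0"
      "\<And>f e. \<lbrakk>f \<in> M; 0 < e\<rbrakk> \<Longrightarrow>
        \<exists>g\<in>S. (\<forall>x\<in>topspace X. re (f x) \<le> re (g x)) \<and> re (Tinf g y) < re (f x0) + e"
      by (rule choquet_point[OF _ x]) (rule that)
    from this(1)[OF f] this(2)[OF f, of "e / 2"] e show ?thesis
      by simp
  qed
  then obtain G where G: "\<And>y. y \<in> K \<Longrightarrow> G y \<in> S"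
    "\<And>y x. \<lbrakk>y \<in> K; x \<in> topspace X\<rbrakk> \<Longrightarrow> re (f x) \<le> re (G y x)"
    "\<And>y. y \<in> K \<Longrightarrow> re (Tinf (G y) y) < re (Tinf f y) + e / 2"
    by metis
  have KY: "K \<subseteq> topspace Y"
    using K(1) by (rule compactin_subset_topspace)
  define U where "U z = {y \<in> topspace Y. re (Tinf (G z) y) < re (Tinf f y) + e / 2}" for z
  have "openin Y (U z)" if z: "z \<in> K" for z
  proof -
    have "continuous_map Y euclideanreal (\<lambda>y. re (Tinf f y) + e / 2 - re (Tinf (G z) y))"
      using Tinf_Cfun[OF f] Tinf_Cfun[OF S_M[OF G(1)[OF z]]]
      by (intro continuous_intros continuous_map_re) (auto simp: Cfun_def)
    from openin_continuous_map_preimage[OF this, of "{0<..}"] show ?thesis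
      by (simp add: U_def)
  qed
  moreover have "K \<subseteq> \<Union> (U ` K)"
    using G(3) KY by (auto simp: U_def)
  ultimately obtain \<F> where "finite \<F>" "\<F> \<subseteq> U ` K" "K \<subseteq> \<Union> \<F>"
    using compactinD[OF K(1), of "U ` K"] by auto
  then obtain F where F: "finite F" "F \<subseteq> K" "K \<subseteq> (\<Union>z\<in>F. U z)"
    by (metis finite_subset_image)
  have "\<forall>\<^sub>F n in sequentially. \<forall>z\<in>F. supnorm Y (\<lambda>y. T n (G z) y - Tinf (G z) y) < e / 2"
    using F G(1) conv e
    by (intro eventually_ball_finite ballI order_tendstoD(2)[of _ 0]) auto
  then show ?thesis
  proof (rule eventually_mono, intro ballI)
    fix n y assume n: "\<forall>z\<in>F. supnorm Y (\<lambda>y. T n (G z) y - Tinf (G z) y) < e / 2" and y: "y \<in> K"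
    obtain z where z: "z \<in> F" "y \<in> U z"
      using F(3) y by blast
    have zK: "z \<in> K" and yY: "y \<in> topspace Y"
      using z(1) F(2) KY y by auto
    have "re (T n f y) \<le> re (T n (G z) y)"
      by (intro T_re_mono f S_M G(1,2) zK yY)
    moreover have "re (T n (G z) y) - re (Tinf (G z) y) \<le> supnorm Y (\<lambda>y. T n (G z) y - Tinf (G z) y)"
      using abs_re_le[of "T n (G z) y - Tinf (G z) y"]
        norm_le_supnorm[OF T_diff_bounded[OF S_M[OF G(1)[OF zK]]] yY, of n]
      by (simp add: re_diff)
    ultimately show "re (T n f y) < re (Tinf f y) + e"
      using n[rule_format, OF z(1)] z(2) by (simp add: U_def)
  qed
qed

text \<open>The one-sided bound for \<open>c * f\<close> with \<open>c\<close> equal to 1, -1,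
  \<open>J\<close> and \<open>- J\<close> controls the real and imaginary parts from both sides; on
  \<open>K\<close> the factor \<open>c\<close> passes through \<open>Tinf\<close> by
  \<open>choquet_point\<close>. That lemma requires a point of \<open>X\<close>, so empty
  \<open>X\<close> is treated apart: there \<open>f\<close> is the zero function, hence in
  \<open>S\<close>.\<close>

lemma eventually_norm_le:
  assumes K: "compactin Y K" "K \<subseteq> choquet_boundary Y (Tinf ` S)" and f: "f \<in> M" and e: "0 < e"
  shows "\<forall>\<^sub>F n in sequentially. \<forall>y\<in>K. norm (T n f y - Tinf f y) \<le> e"
proof (cases "topspace X = {}")
  case True
  then have "f = (\<lambda>x. 0)"
    using M(2) f by (auto simp: Cfun_def)
  then have fS: "f \<in> S"
    using S_zero by simp
  have "\<forall>\<^sub>F n in sequentially. supnorm Y (\<lambda>y. T n f y - Tinf f y) < e"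
    using order_tendstoD(2)[OF conv[OF fS] e] .
  then show ?thesis
  proof (rule eventually_mono, intro ballI)
    fix n y assume n: "supnorm Y (\<lambda>y. T n f y - Tinf f y) < e" and "y \<in> K"
    then have "y \<in> topspace Y"
      using compactin_subset_topspace[OF K(1)] by blast
    from norm_le_supnorm[OF T_diff_bounded[OF f] this, of n] n
    show "norm (T n f y - Tinf f y) \<le> e"
      by simp
  qed
next
  case False
  then obtain x where x: "x \<in> topspace X"
    by blast
  have ev: "\<forall>\<^sub>F n in sequentially. \<forall>y\<in>K. re (c * (T n f y - Tinf f y)) < e / 2" for c
  proof -
    have Tinf_cf: "Tinf (\<lambda>x. c * f x) y = c * Tinf f y" if "y \<in> K" for y
    proof -
      have "y \<in> choquet_boundary Y (Tinf ` S)"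
        using K(2) that by blast
      then obtain x0 where "\<And>f. f \<in> M \<Longrightarrow> Tinf f y = f x0"
        by (rule choquet_point[OF _ x]) (rule that)
      from this[OF f] this[OF M_scale[OF f, of c]] show ?thesis
        by simp
    qed
    have "\<forall>\<^sub>F n in sequentially. \<forall>y\<in>K. re (T n (\<lambda>x. c * f x) y) < re (Tinf (\<lambda>x. c * f x) y) + e / 2"
      using e by (intro eventually_re_less[OF K x M_scale[OF f]]) simp
    then show ?thesis
    proof (rule eventually_mono, intro ballI)
      fix n y
      assume less: "\<forall>y\<in>K. re (T n (\<lambda>x. c * f x) y) < re (Tinf (\<lambda>x. c * f x) y) + e / 2"
        and y: "y \<in> K"
      show "re (c * (T n f y - Tinf f y)) < e / 2"
        using less[rule_format, OF y]
        by (simp add: T_scale[OF f] Tinf_cf[OF y] right_diff_distrib re_diff)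
    qed
  qed
  from ev[of 1] ev[of "- 1"] ev[of J] ev[of "- J"] show ?thesis
  proof eventually_elim
    case (elim n)
    show ?case
    proof
      fix y assume y: "y \<in> K"
      define d where "d = T n f y - Tinf f y"
      have "re d < e / 2" "- re d < e / 2" "re (J * d) < e / 2" "- re (J * d) < e / 2"
        using elim[THEN bspec, OF y] unfolding d_def[symmetric] by (simp_all add: re_minus)
      then have "\<bar>re d\<bar> + \<bar>re (J * d)\<bar> \<le> e"
        by linarith
      then show "norm (T n f y - Tinf f y) \<le> e"
        using norm_le_re[of d] by (simp add: d_def)
    qed
  qed
qed

end

lemma Sup_insert_zero_tendsto_0:
  fixes a :: "nat \<Rightarrow> 'b \<Rightarrow> real"
  assumes nonneg: "\<And>n y. y \<in> K \<Longrightarrow> 0 \<le> a n y"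
    and ev: "\<And>e. 0 < e \<Longrightarrow> \<forall>\<^sub>F n in sequentially. \<forall>y\<in>K. a n y \<le> e"
  shows "(\<lambda>n. Sup (insert 0 (a n ` K))) \<longlonglongrightarrow> 0"
proof (rule tendstoI)
  fix e :: real assume e: "0 < e"
  have "\<forall>\<^sub>F n in sequentially. \<forall>y\<in>K. a n y \<le> e / 2"
    using ev[of "e / 2"] e by simp
  then show "\<forall>\<^sub>F n in sequentially. dist (Sup (insert 0 (a n ` K))) 0 < e"
  proof eventually_elim
    case (elim n)
    then have bound: "z \<le> e / 2" if "z \<in> insert 0 (a n ` K)" for z
      using that e by auto
    have "0 \<le> Sup (insert 0 (a n ` K))"
      by (intro cSup_upper bdd_aboveI[OF bound]) auto
    moreover have "Sup (insert 0 (a n ` K)) \<le> e / 2"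
      using bound by (intro cSup_least) auto
    ultimately show ?case
      using e by simp
  qed
qed

theorem theorem3p2:
  fixes X :: "'a topology" and Y :: "'b topology"
    and M S :: "('a \<Rightarrow> 'k::real_normed_field) set"
    and T :: "nat \<Rightarrow> ('a \<Rightarrow> 'k) \<Rightarrow> ('b \<Rightarrow> 'k)"
    and Tinf :: "('a \<Rightarrow> 'k) \<Rightarrow> ('b \<Rightarrow> 'k)"
  assumes X: "compact_space X" "Hausdorff_space X"
    and Y: "compact_space Y" "Hausdorff_space Y"
    and M: "lin_subspace M" "M \<subseteq> Cfun X" "self_conjugate M"
    and S: "function_space X S" "S \<subseteq> M"
    and Tn: "\<And>n. linear_map_on M (T n)" "\<And>n. T n ` M \<subseteq> Cfun Y" "\<And>n. positive_map_on X Y M (T n)"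
    and Tinf_into: "Tinf ` M \<subseteq> Cfun Y"
    and Tinf_subspace: "lin_subspace (Tinf ` M)"
    and Tinf_isom: "\<And>f g. f \<in> M \<Longrightarrow> g \<in> M \<Longrightarrow>
          supnorm Y (\<lambda>y. Tinf f y - Tinf g y) = supnorm X (\<lambda>x. f x - g x)"
    and conv: "\<And>f. f \<in> S \<Longrightarrow> (\<lambda>n. supnorm Y (\<lambda>y. T n f y - Tinf f y)) \<longlonglongrightarrow> 0"
  shows "\<forall>f\<in>M. \<forall>K. compactin Y K \<and> K \<subseteq> choquet_boundary Y (Tinf ` S) \<longrightarrow>
           (\<lambda>n. Sup (insert 0 ((\<lambda>y. norm (T n f y - Tinf f y)) ` K))) \<longlonglongrightarrow> 0"
proof (intro ballI allI impI, elim conjE)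
  fix f K assume f: "f \<in> M" and K: "compactin Y K" "K \<subseteq> choquet_boundary Y (Tinf ` S)"
  \<comment> \<open>Fixing a real part for the scalar field treats real and complex scalars
    together.\<close>
  obtain re and J :: 'k where "real_part re J"
    using ex_real_part by blast
  then interpret korovkin re J X Y M S T Tinf
    by (intro korovkin.intro korovkin_axioms.intro X(1) Y(1) M S Tn Tinf_into Tinf_isom conv)
  show "(\<lambda>n. Sup (insert 0 ((\<lambda>y. norm (T n f y - Tinf f y)) ` K))) \<longlonglongrightarrow> 0"
    by (intro Sup_insert_zero_tendsto_0 eventually_norm_le[OF K f]) auto
qed

end
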